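(* For every integer $p\ge 3$, $$f_{p+1}\big(n,\mathrm{ex}(n,K_p)+1\big)=\left(\frac{2(p-2)^2}{p(4p^2-11p+8)}+o(1)\right)n^2,$$ where $p$ is fixed and $o(1)\to 0$ as $n\to\infty$.
   Context: All graphs are finite and simple. $\mathrm{ex}(n,K_p)$ denotes the maximum number of edges in an $n$-vertex graph containing no copy of $K_p$ as a subgraph. For a $K_q$-free graph $G$, a non-edge $e$ of $G$ (i.e. a pair of distinct non-adjacent vertices) is called a $K_q$-saturating edge of $G$ if $G+e$ contains a copy of $K_q$. $f_q(G)$ denotes the number of $K_q$-saturating edges of $G$, and $f_q(n,m)$ denotes the minimum of $f_q(G)$ over all $n$-vertex $K_q$-free graphs $G$ with exactly $m$ edges. *)

theory Defs
  imports Complex_Main "HOL-Library.Ramsey"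
begin

text \<open>Vertices are natural numbers; this loses nothing, since every finite graph is isomorphic to
  one on a finite set of naturals. Edges are unordered pairs.\<close>

definition sgraph :: "nat set \<Rightarrow> nat set set \<Rightarrow> bool" where
  "sgraph V E \<longleftrightarrow> finite V \<and> E \<subseteq> [V]\<^bsup>2\<^esup>"

text \<open>A copy of the complete graph \<open>K\<^sub>q\<close> as a subgraph is a set of \<open>q\<close> pairwise adjacent vertices.\<close>

definition contains_K :: "nat \<Rightarrow> nat set \<Rightarrow> nat set set \<Rightarrow> bool" where
  "contains_K q V E \<longleftrightarrow> (\<exists>K\<subseteq>V. card K = q \<and> clique K E)"

text \<open>For \<open>q \<ge> 2\<close> the edgeless graph is \<open>K\<^sub>q\<close>-free, so the maximum is over a nonempty set.\<close>

definition ex_K :: "nat \<Rightarrow> nat \<Rightarrow> nat" where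
  "ex_K n q = Max {card E | V E. sgraph V E \<and> card V = n \<and> \<not> contains_K q V E}"

definition saturating_edges :: "nat \<Rightarrow> nat set \<Rightarrow> nat set set \<Rightarrow> nat set set" where
  "saturating_edges q V E = {e \<in> [V]\<^bsup>2\<^esup> - E. contains_K q V (insert e E)}"

definition num_saturating :: "nat \<Rightarrow> nat set \<Rightarrow> nat set set \<Rightarrow> nat" where
  "num_saturating q V E = card (saturating_edges q V E)"

text \<open>Meaningful only if some \<open>K\<^sub>q\<close>-free graph on \<open>n\<close> vertices has exactly \<open>m\<close> edges;
  otherwise this is the unspecified value \<open>Min {}\<close>.\<close>

definition min_saturating :: "nat \<Rightarrow> nat \<Rightarrow> nat \<Rightarrow> nat" where
  "min_saturating q n m =
     Min {num_saturating q V E | V E.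
            sgraph V E \<and> card V = n \<and> card E = m \<and> \<not> contains_K q V E}"

lemma sgraph_finite_edges: "sgraph V E \<Longrightarrow> finite E"
  unfolding sgraph_def by (meson finite_imp_finite_nsets finite_subset)

lemma sgraph_card_le:
  assumes "sgraph V E" "card V = n"
  shows "card E \<le> n choose 2"
proof -
  have "card E \<le> card ([V]\<^bsup>2\<^esup>)"
    using assms(1) unfolding sgraph_def by (meson card_mono finite_imp_finite_nsets)
  then show ?thesis
    using assms by (simp add: card_nsets)
qed

lemma finite_ex_K_set:
  "finite {card E | V E. sgraph V E \<and> card V = n \<and> \<not> contains_K q V E}"
  by (rule finite_subset[of _ "{..n choose 2}"]) (auto dest: sgraph_card_le)

lemma ex_K_set_nonempty:
  assumes "q \<ge> 2"
  shows "{card E | V E. sgraph V E \<and> card V = n \<and> \<not> contains_K q V E} \<noteq> {}"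
proof -
  have "\<not> clique K {}" if "card K = q" for K :: "nat set"
  proof
    assume "clique K {}"
    then have "\<forall>v\<in>K. \<forall>w\<in>K. v = w" by (auto simp: clique_def)
    then have "card K \<le> 1" by (metis card_le_Suc0_iff_eq card.infinite One_nat_def zero_le_one)
    with that assms show False by simp
  qed
  then have "sgraph {..<n} {} \<and> card {..<n} = n \<and> \<not> contains_K q {..<n} {}"
    by (auto simp: sgraph_def contains_K_def)
  then show ?thesis by blast
qed

lemma num_saturating_le:
  assumes "sgraph V E" "card V = n"
  shows "num_saturating q V E \<le> n choose 2"
proof -
  have "card (saturating_edges q V E) \<le> card ([V]\<^bsup>2\<^esup>)"
    using assms(1) unfolding sgraph_def saturating_edges_def
    by (intro card_mono finite_imp_finite_nsets) auto
  then show ?thesis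
    using assms by (simp add: card_nsets num_saturating_def)
qed

lemma finite_min_saturating_set:
  "finite {num_saturating q V E | V E.
     sgraph V E \<and> card V = n \<and> card E = m \<and> \<not> contains_K q V E}"
  by (rule finite_subset[of _ "{..n choose 2}"]) (auto dest: num_saturating_le)

text \<open>Adding any edge to an extremal \<open>K\<^sub>p\<close>-free graph cannot create a \<open>K\<^sub>p\<^sub>+\<^sub>1\<close>, so the minimum below
  is over a nonempty set as soon as \<open>n \<ge> p\<close>.\<close>

lemma min_saturating_set_nonempty:
  assumes "p \<ge> 2" "n \<ge> p"
  shows "{num_saturating (p + 1) V E | V E.
     sgraph V E \<and> card V = n \<and> card E = ex_K n p + 1 \<and> \<not> contains_K (p + 1) V E} \<noteq> {}"
proof -
  have "ex_K n p \<in> {card E | V E. sgraph V E \<and> card V = n \<and> \<not> contains_K p V E}"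
    unfolding ex_K_def by (rule Max_in[OF finite_ex_K_set ex_K_set_nonempty[OF assms(1)]])
  then obtain V E where VE: "sgraph V E" "card V = n" "\<not> contains_K p V E" "card E = ex_K n p"
    by auto
  obtain K where K: "K \<subseteq> V" "card K = p"
    using assms(2) VE(2) by (metis obtain_subset_with_card_n)
  then have "\<not> clique K E" using VE(3) by (auto simp: contains_K_def)
  then obtain u v where uv: "u \<in> K" "v \<in> K" "u \<noteq> v" "{u, v} \<notin> E" by (auto simp: clique_def)
  let ?E = "insert {u, v} E"
  have "sgraph V ?E"
    using VE(1) uv K(1) by (auto simp: sgraph_def nsets_def)
  moreover have "card ?E = ex_K n p + 1"
    using VE(4) uv(4) sgraph_finite_edges[OF VE(1)] by simp
  moreover have "\<not> contains_K (p + 1) V ?E"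
  proof
    assume "contains_K (p + 1) V ?E"
    then obtain L where L: "L \<subseteq> V" "card L = p + 1" "clique L ?E"
      by (auto simp: contains_K_def)
    obtain x where x: "x \<in> L" "u \<in> L \<Longrightarrow> x = u"
      using L(2) by (metis card.empty equals0I add_is_0 one_neq_zero)
    have "finite L" using L(2) by (metis card.infinite add_is_0 one_neq_zero)
    then have "card (L - {x}) = p" using x(1) L(2) by simp
    moreover have "clique (L - {x}) E"
      using L(3) x(2) unfolding clique_def by (metis DiffD1 DiffD2 doubleton_eq_iff insertE singletonI)
    ultimately show False using VE(3) L(1) unfolding contains_K_def by blast
  qed
  ultimately show ?thesis using VE(2) by blast
qed

end

theory Submission
  imports Defs
begin

text \<open>Write \<open>q = p - 1\<close> and \<open>a = 1 - 1/q\<close>, so that \<open>ex_K n p\<close> is \<open>a n\<^sup>2 / 2\<close> up to a constant (\<open>ex_K_le\<close>, \<open>ex_K_ge\<close>).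

Upper bound. Take a balanced complete \<open>q\<close>-partite graph and join an independent set \<open>U\<close> of \<open>u\<close> further vertices to \<open>t\<close>
vertices in each class. A \<open>p\<close>-clique uses exactly one vertex of \<open>U\<close>, and the only saturating edges lie within
\<open>U\<close> or within the joined part of one class, about \<open>u\<^sup>2/2 + q t\<^sup>2/2\<close> of them. The edge count requires
\<open>q t = a (n - u/2)\<close> up to a constant, and minimising over \<open>u\<close> gives the claimed density. Surplus edges are deleted, which creates
no saturating edge (\<open>min_saturating_le\<close>, \<open>min_saturating_upper\<close>).

Lower bound. Let \<open>W\<close> be the vertex set of a largest family of \<open>k\<close> disjoint \<open>p\<close>-cliques and \<open>R\<close> the other vertices;
\<open>k \<ge> 1\<close> because of the extra edge. A vertex outside a \<open>p\<close>-clique \<open>T\<close> sends at most \<open>p - 2\<close> edges to \<open>T\<close>, or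
\<open>p - 1\<close> edges and then forms a saturating edge with the vertex it misses. Since \<open>R\<close> is \<open>K\<^sub>p\<close>-free, it spans at most
\<open>a |R|\<^sup>2 / 2\<close> edges, so the remaining edges force about \<open>a k (n - p k / 2)\<close> saturating edges meeting \<open>W\<close>. It also
follows that for some \<open>T\<close> many vertices of \<open>R\<close> see all of \<open>T\<close> but one vertex. Those missing the same vertex of \<open>T\<close> pairwise form
saturating edges, which yields a second, quadratic contribution inside \<open>R\<close>.

For this contribution to be sharp, only \<open>p - 1\<close> of the \<open>p\<close> vertices of the clique may be missed. This is achieved by choosing
the family so that, moreover, \<open>R\<close> spans as many edges as possible, and replacing \<open>T\<close> by the \<open>p\<close>-clique in \<open>R \<union> T\<close> that
uses the most vertices of \<open>R\<close> (\<open>exchange_clique\<close>). The two contributions add up to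
\<open>c/2 (n - k/2)\<^sup>2 + k\<^sup>2/2\<close> with \<open>c = (q - 1)\<^sup>2 / q\<^sup>3\<close>, the same function of \<open>k\<close> as the count of the construction is of
\<open>u\<close>, and its minimum over \<open>k\<close> is the claimed density (\<open>density_tradeoff\<close>).\<close>

section \<open>Ordered edge counts and Turan's upper bound\<close>

definition nbrs :: "nat set set \<Rightarrow> nat \<Rightarrow> nat set \<Rightarrow> nat set" where
  "nbrs E v A = {a \<in> A. {v, a} \<in> E}"

text \<open>Every edge count is taken over ordered pairs: \<open>pairs E A B\<close> is additive in both arguments, so sums over
a partition of the vertices need no case distinction, and on a whole vertex set it is twice the
number of edges. The set \<open>E\<close> will be either the edge set of the graph or its set of saturating edges.\<close>

definition pairs :: "nat set set \<Rightarrow> nat set \<Rightarrow> nat set \<Rightarrow> nat" where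
  "pairs E A B = (\<Sum>v\<in>A. card (nbrs E v B))"

lemma nbrs_subset: "nbrs E v A \<subseteq> A"
  by (auto simp: nbrs_def)

lemma finite_nbrs [simp]: "finite A \<Longrightarrow> finite (nbrs E v A)"
  by (simp add: nbrs_def)

lemma card_nbrs_Un:
  assumes "finite A" "finite B" "A \<inter> B = {}"
  shows "card (nbrs E v (A \<union> B)) = card (nbrs E v A) + card (nbrs E v B)"
proof -
  have "nbrs E v (A \<union> B) = nbrs E v A \<union> nbrs E v B" by (auto simp: nbrs_def)
  then show ?thesis
    using assms by (simp add: card_Un_disjoint disjoint_iff nbrs_def)
qed

lemma pairs_Un_left:
  "\<lbrakk>finite A; finite B; A \<inter> B = {}\<rbrakk> \<Longrightarrow> pairs E (A \<union> B) C = pairs E A C + pairs E B C"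
  by (simp add: pairs_def sum.union_disjoint)

lemma pairs_Un_right:
  "\<lbrakk>finite A; finite B; A \<inter> B = {}\<rbrakk> \<Longrightarrow> pairs E C (A \<union> B) = pairs E C A + pairs E C B"
  by (simp add: pairs_def card_nbrs_Un sum.distrib)

lemma card_nbrs_sum: "finite A \<Longrightarrow> card (nbrs E v A) = (\<Sum>a\<in>A. of_bool ({v, a} \<in> E))"
  by (simp add: nbrs_def Int_def)

lemma pairs_commute:
  assumes "finite A" "finite B"
  shows "pairs E A B = pairs E B A"
proof -
  have "pairs E A B = (\<Sum>v\<in>A. \<Sum>w\<in>B. of_bool ({v, w} \<in> E))"
    using assms by (simp add: pairs_def card_nbrs_sum)
  also have "\<dots> = (\<Sum>w\<in>B. \<Sum>v\<in>A. of_bool ({w, v} \<in> E))"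
    by (subst sum.swap) (simp add: insert_commute)
  also have "\<dots> = pairs E B A"
    using assms by (simp add: pairs_def card_nbrs_sum)
  finally show ?thesis .
qed

lemma pairs_square_Un:
  assumes "finite A" "finite B" "A \<inter> B = {}"
  shows "pairs E (A \<union> B) (A \<union> B) = pairs E A A + 2 * pairs E A B + pairs E B B"
  using assms by (simp add: pairs_Un_left pairs_Un_right pairs_commute[of B A])

lemma pairs_le_sum:
  assumes "\<And>v. v \<in> A \<Longrightarrow> card (nbrs E v B) \<le> d"
  shows "pairs E A B \<le> d * card A"
  using sum_bounded_above[of A "\<lambda>v. card (nbrs E v B)" d] assms by (simp add: pairs_def mult.commute)

lemma pairs_le_mult:
  assumes "finite B"
  shows "pairs E A B \<le> card A * card B"
  using pairs_le_sum[of A E B "card B"] assms by (simp add: card_mono nbrs_subset mult.commute)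

lemma pairs_eq_twice_card:
  assumes "finite V" "E \<subseteq> [V]\<^bsup>2\<^esup>"
  shows "pairs E V V = 2 * card E"
proof -
  have finE: "finite E" using assms by (meson finite_imp_finite_nsets finite_subset)
  have e2: "card e = 2" "e \<subseteq> V" if "e \<in> E" for e
    using that assms(2) by (auto simp: nsets_def)
  have "card (nbrs E v V) = card {e \<in> E. v \<in> e}" for v
  proof (rule bij_betw_same_card)
    show "bij_betw (\<lambda>w. {v, w}) (nbrs E v V) {e \<in> E. v \<in> e}"
      unfolding bij_betw_def
    proof
      show "inj_on (\<lambda>w. {v, w}) (nbrs E v V)"
        by (auto simp: inj_on_def doubleton_eq_iff)
      show "(\<lambda>w. {v, w}) ` nbrs E v V = {e \<in> E. v \<in> e}"
      proof (intro equalityI subsetI)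
        fix e assume e: "e \<in> {e \<in> E. v \<in> e}"
        then obtain x y where "e = {x, y}" using e2(1) by (metis card_2_iff mem_Collect_eq)
        with e obtain w where "e = {v, w}" by auto
        with e e2(2)[of e] show "e \<in> (\<lambda>w. {v, w}) ` nbrs E v V" by (auto simp: nbrs_def)
      qed (auto simp: nbrs_def)
    qed
  qed
  then have "pairs E V V = (\<Sum>v\<in>V. card {e \<in> E. v \<in> e})" by (simp add: pairs_def)
  also have "\<dots> = (\<Sum>v\<in>V. \<Sum>e\<in>E. of_bool (v \<in> e))"
    using finE by (simp add: Int_def)
  also have "\<dots> = (\<Sum>e\<in>E. \<Sum>v\<in>V. of_bool (v \<in> e))" by (rule sum.swap)
  also have "\<dots> = (\<Sum>e\<in>E. 2)"
  proof (rule sum.cong[OF refl])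
    fix e assume "e \<in> E"
    then have "V \<inter> e = e" using e2(2) by auto
    then show "(\<Sum>v\<in>V. of_bool (v \<in> e)) = (2::nat)"
      using assms(1) e2(1)[OF \<open>e \<in> E\<close>] by (simp add: Int_def)
  qed
  finally show ?thesis by simp
qed

lemma contains_KI: "K \<subseteq> V \<Longrightarrow> card K = q \<Longrightarrow> clique K E \<Longrightarrow> contains_K q V E"
  by (auto simp: contains_K_def)

lemma clique_mono: "clique K E \<Longrightarrow> L \<subseteq> K \<Longrightarrow> clique L E"
  by (auto simp: clique_def)

lemma clique_insert:
  assumes "clique K E" "\<And>x. x \<in> K \<Longrightarrow> {v, x} \<in> E"
  shows "clique (insert v K) E"
  using assms by (auto simp: clique_def insert_commute)

lemma card_nbrs_clique_le:
  assumes "\<not> contains_K (q + 1) R E" "\<And>v. {v} \<notin> E"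
    and "K \<subseteq> R" "finite K" "card K = q" "clique K E" "v \<in> R"
  shows "card (nbrs E v K) \<le> q - 1"
proof -
  have "nbrs E v K \<noteq> K"
  proof
    assume eq: "nbrs E v K = K"
    then have adj: "\<And>x. x \<in> K \<Longrightarrow> {v, x} \<in> E" by (auto simp: nbrs_def)
    have "v \<notin> K" using adj[of v] assms(2) by auto
    then have "card (insert v K) = q + 1" using assms by simp
    moreover have "clique (insert v K) E" using clique_insert[OF assms(6) adj] .
    ultimately show False using assms(1,3,7) contains_KI[of "insert v K" R "q + 1" E] by simp
  qed
  then have "nbrs E v K \<subset> K" using nbrs_subset by blast
  then have "card (nbrs E v K) < q" using psubset_card_mono assms(4,5) by blast
  then show ?thesis by simp
qed

text \<open>This is Turan's theorem in the form without rounding. A vertex sees at most \<open>q - 1\<close> vertices of a \<open>q\<close>-clique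
\<open>K\<close>, since seeing all of them would extend the clique. Removing \<open>K\<close> and using the bound for the rest gives
the right-hand side exactly, as \<open>(n - q)\<^sup>2 + 2 q (n - q) + q\<^sup>2 = n\<^sup>2\<close>. If there is no \<open>q\<close>-clique, the bound
for \<open>q - 1\<close> is stronger.\<close>

lemma turan_bound:
  assumes "finite R" "\<And>v. {v} \<notin> E" "q \<ge> 1" "\<not> contains_K (q + 1) R E"
  shows "real (pairs E R R) \<le> (real q - 1) / real q * (real (card R))\<^sup>2"
  using assms(3,1,4)
proof (induction q arbitrary: R rule: dec_induct)
  case base
  have "nbrs E v R = {}" if "v \<in> R" for v
  proof (rule ccontr)
    assume "nbrs E v R \<noteq> {}"
    then obtain w where w: "w \<in> R" "{v, w} \<in> E" by (auto simp: nbrs_def)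
    then have "v \<noteq> w" using assms(2)[of v] by auto
    then have "card {v, w} = 1 + 1" "clique {v, w} E"
      using w by (auto simp: clique_def insert_commute)
    then have "contains_K (1 + 1) R E" using that w(1) by (intro contains_KI[of "{v, w}"]) auto
    then show False using base(2) by simp
  qed
  then show ?case by (simp add: pairs_def)
next
  case (step q)
  from step.prems show ?case
  proof (induction "card R" arbitrary: R rule: less_induct)
    case less
    show ?case
    proof (cases "contains_K (Suc q) R E")
      case False
      then have "real (pairs E R R) \<le> (real q - 1) / real q * (real (card R))\<^sup>2"
        using step.IH less.prems(1) by simp
      also have "\<dots> \<le> (real (Suc q) - 1) / real (Suc q) * (real (card R))\<^sup>2"
        using step.hyps by (intro mult_right_mono) (auto simp: field_simps)
      finally show ?thesis .
    next
      case True
      then obtain K where K: "K \<subseteq> R" "card K = Suc q" "clique K E"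
        by (auto simp: contains_K_def)
      have finK: "finite K" using K(1) less.prems(1) finite_subset by blast
      define A where "A = R - K"
      have A: "finite A" "A \<inter> K = {}" "R = A \<union> K" using K(1) less.prems(1) by (auto simp: A_def)
      have cR: "card R = card A + Suc q" using A K(2) finK by (simp add: card_Un_disjoint)
      have d: "card (nbrs E v K) \<le> q" if "v \<in> R" for v
        using card_nbrs_clique_le[OF less.prems(2) assms(2) K(1) finK K(2,3) that] by simp
      have 1: "real (pairs E A A) \<le> (real (Suc q) - 1) / real (Suc q) * (real (card A))\<^sup>2"
      proof (rule less.hyps)
        show "card A < card R" using cR by simp
        show "\<not> contains_K (Suc q + 1) A E" using less.prems(2) A(3) by (auto simp: contains_K_def)
      qed (rule A(1))
      have "pairs E A K \<le> q * card A" "pairs E K K \<le> q * card K"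
        using d A(3) by (auto intro!: pairs_le_sum)
      then have "real (pairs E A K) \<le> real (q * card A)" "real (pairs E K K) \<le> real (q * card K)"
        by (simp_all only: of_nat_le_iff)
      then have 2: "real (pairs E A K) \<le> real q * real (card A)"
        and 3: "real (pairs E K K) \<le> real q * (real q + 1)"
        using K(2) by (simp_all add: algebra_simps)
      have "real (pairs E R R) = real (pairs E A A) + 2 * real (pairs E A K) + real (pairs E K K)"
        using pairs_square_Un[OF A(1) finK A(2), of E] A(3) by simp
      also have "\<dots> \<le> (real (Suc q) - 1) / real (Suc q) * (real (card A))\<^sup>2
          + 2 * (real q * real (card A)) + real q * (real q + 1)"
        using 1 2 3 by linarith
      also have "\<dots> = (real (Suc q) - 1) / real (Suc q) * (real (card R))\<^sup>2"
        by (simp add: cR field_simps power2_eq_square)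
      finally show ?thesis .
    qed
  qed
qed

section \<open>Balanced multipartite graphs and the extremal number\<close>

text \<open>On an interval of naturals this is a Turan graph: the complete \<open>q\<close>-partite graph whose classes, the
residues modulo \<open>q\<close>, differ in size by at most one.\<close>

definition residue_graph :: "nat \<Rightarrow> nat set \<Rightarrow> nat set set" where
  "residue_graph q A = {{x, y} | x y. x \<in> A \<and> y \<in> A \<and> x mod q \<noteq> y mod q}"

lemma residue_graph_iff:
  "{x, y} \<in> residue_graph q A \<longleftrightarrow> x \<in> A \<and> y \<in> A \<and> x mod q \<noteq> y mod q"
  by (auto simp: residue_graph_def doubleton_eq_iff)

lemma residue_graph_subset: "residue_graph q A \<subseteq> [A]\<^bsup>2\<^esup>"
  by (auto simp: residue_graph_def nsets_def card_2_iff)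

text \<open>The residues of the vertices of a clique are distinct, so there are at most \<open>q\<close> of them.\<close>

lemma card_residue_clique:
  assumes "finite K" "q \<ge> 1"
    and "\<And>x y. \<lbrakk>x \<in> K; y \<in> K; x \<noteq> y\<rbrakk> \<Longrightarrow> x mod q \<noteq> y mod q"
  shows "card K \<le> q"
proof -
  have "card K \<le> card {..<q}"
  proof (rule card_inj_on_le)
    show "inj_on (\<lambda>x. x mod q) K" using assms(3) by (auto simp: inj_on_def)
  qed (use assms(2) in auto)
  then show ?thesis by simp
qed

text \<open>Each \<open>j\<close> counted lies a positive multiple of \<open>q\<close>, of size at most \<open>m\<close>, below \<open>u + m\<close>. This is what the next
vertex \<open>u + m\<close> fails to see when the residue graph is built vertex by vertex.\<close>

lemma card_same_residue:
  fixes q u m :: nat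
  assumes "q \<ge> 1"
  shows "card {j \<in> {u..<u + m}. j mod q = (u + m) mod q} \<le> m div q"
proof -
  have div: "q dvd u + m - j" if "j \<in> {j \<in> {u..<u + m}. j mod q = (u + m) mod q}" for j
    using that by (intro mod_eq_dvd_iff_nat[THEN iffD1]) auto
  have "card {j \<in> {u..<u + m}. j mod q = (u + m) mod q} \<le> card {1..m div q}"
  proof (rule card_inj_on_le)
    show "inj_on (\<lambda>j. (u + m - j) div q) {j \<in> {u..<u + m}. j mod q = (u + m) mod q}"
    proof (rule inj_onI)
      fix i j
      assume i: "i \<in> {j \<in> {u..<u + m}. j mod q = (u + m) mod q}"
        and j: "j \<in> {j \<in> {u..<u + m}. j mod q = (u + m) mod q}"
        and "(u + m - i) div q = (u + m - j) div q"
      then have "u + m - i = u + m - j" using div[OF i] div[OF j] by (metis dvd_div_mult_self)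
      then show "i = j" using i j by auto
    qed
    show "(\<lambda>j. (u + m - j) div q) ` {j \<in> {u..<u + m}. j mod q = (u + m) mod q} \<subseteq> {1..m div q}"
    proof
      fix x assume "x \<in> (\<lambda>j. (u + m - j) div q) ` {j \<in> {u..<u + m}. j mod q = (u + m) mod q}"
      then obtain j where j: "j \<in> {j \<in> {u..<u + m}. j mod q = (u + m) mod q}"
        and x: "x = (u + m - j) div q" by auto
      have "x * q = u + m - j" using div[OF j] x by simp
      moreover have "u + m - j > 0" using j by auto
      ultimately have "x \<noteq> 0" by (intro notI) simp
      moreover have "x \<le> m div q" unfolding x by (rule div_le_mono) (use j in auto)
      ultimately show "x \<in> {1..m div q}" by simp
    qed
  qed simp
  then show ?thesis by simp
qed

text \<open>The term with \<open>m mod q\<close> is the exact deficit against \<open>(1 - 1/q) m\<^sup>2\<close>, which makes the induction on \<open>m\<close> close.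
The deficit stays bounded as \<open>m\<close> grows. That matters later: a linear error would swamp the count when the
clique packing of the graph is small.\<close>

lemma residue_graph_pairs_exact:
  fixes q u m :: nat
  assumes "q \<ge> 1"
    and E: "\<And>x y. {x, y} \<in> E \<longleftrightarrow> x \<in> A \<and> y \<in> A \<and> x mod q \<noteq> y mod q"
    and "{u..<u + m} \<subseteq> A"
  shows "(real q - 1) * (real m)\<^sup>2 \<le> real q * real (pairs E {u..<u + m} {u..<u + m})
      + real (m mod q) * (real q - real (m mod q))"
  using assms(3)
proof (induction m)
  case 0
  then show ?case by (simp add: pairs_def)
next
  case (Suc m)
  define W where "W = {u..<u + m}"
  define s where "s = card {j \<in> W. j mod q = (u + m) mod q}"
  define b where "b = m mod q"
  have W: "finite W" "u + m \<notin> W" "{u..<u + Suc m} = W \<union> {u + m}" "card W = m" "W \<subseteq> A" "u + m \<in> A"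
    using Suc.prems by (auto simp: W_def)
  have "nbrs E (u + m) W = W - {j \<in> W. j mod q = (u + m) mod q}"
    using W by (auto simp: nbrs_def E)
  then have "card (nbrs E (u + m) W) = m - s"
    using W by (simp add: s_def card_Diff_subset)
  then have "pairs E {u + m} W = m - s" by (simp add: pairs_def)
  then have "pairs E W {u + m} = m - s" using W(1) pairs_commute[of W "{u + m}"] by simp
  moreover have "pairs E {u + m} {u + m} = 0" by (simp add: pairs_def nbrs_def E)
  ultimately have step: "pairs E {u..<u + Suc m} {u..<u + Suc m} = pairs E W W + 2 * (m - s)"
    unfolding W(3) using pairs_square_Un[of W "{u + m}" E] W(1,2) by simp
  have s: "s \<le> m div q" using card_same_residue[OF assms(1)] by (simp add: s_def W_def)
  have "m = q * (m div q) + b" by (simp add: b_def)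
  then have "q * s + b \<le> m" using s by (metis add_le_mono1 mult_le_mono2)
  moreover have "s \<le> m" using s by (meson div_le_dividend le_trans)
  ultimately have "real q * real (m - s) \<ge> real q * real m - real m + real b"
    by (simp add: of_nat_diff right_diff_distrib flip: of_nat_mult of_nat_add)
  moreover have "(real q - 1) * (real m)\<^sup>2 \<le> real q * real (pairs E W W) + real b * (real q - real b)"
    using Suc.IH W(5) unfolding W_def b_def by blast
  ultimately have "(real q - 1) * (real m)\<^sup>2 + 2 * (real q * real m - real m + real b)
      \<le> real q * (real (pairs E W W) + 2 * real (m - s)) + real b * (real q - real b)"
    by (simp add: algebra_simps)
  moreover have "real q - 1 \<le> 2 * real b - real b * (real q - real b)
      + real (Suc m mod q) * (real q - real (Suc m mod q))"
  proof (cases "Suc b = q")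
    case True
    then have "Suc m mod q = 0" unfolding b_def by (simp add: mod_Suc)
    moreover have "real q = real b + 1" using True by auto
    ultimately show ?thesis by (simp add: algebra_simps)
  next
    case False
    then have "Suc m mod q = Suc b" unfolding b_def by (simp add: mod_Suc)
    then show ?thesis by (simp add: algebra_simps)
  qed
  moreover have "real (pairs E {u..<u + Suc m} {u..<u + Suc m}) = real (pairs E W W) + 2 * real (m - s)"
    unfolding step by (simp only: of_nat_add of_nat_mult of_nat_numeral)
  moreover have "(real q - 1) * (real (Suc m))\<^sup>2
      = (real q - 1) * (real m)\<^sup>2 + 2 * (real q * real m - real m) + (real q - 1)"
    by (simp add: algebra_simps power2_eq_square)
  ultimately show ?case by (simp only: distrib_left)
qed

lemma residue_graph_pairs:
  fixes q u m :: nat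
  assumes "q \<ge> 1"
    and E: "\<And>x y. {x, y} \<in> E \<longleftrightarrow> x \<in> A \<and> y \<in> A \<and> x mod q \<noteq> y mod q"
    and "{u..<u + m} \<subseteq> A"
  shows "(real q - 1) / real q * (real m)\<^sup>2 - real q \<le> real (pairs E {u..<u + m} {u..<u + m})"
proof -
  have "real (m mod q) * (real q - real (m mod q)) \<le> real q * real q"
    using assms(1) by (intro mult_mono) (auto simp: less_imp_le)
  then have "(real q - 1) * (real m)\<^sup>2 \<le> real q * (real (pairs E {u..<u + m} {u..<u + m}) + real q)"
    using residue_graph_pairs_exact[OF assms(1) E assms(3)] by (simp add: algebra_simps)
  then show ?thesis using assms(1) by (simp add: field_simps)
qed

lemma ex_K_ge:
  assumes "q \<ge> 1"
  shows "(real q - 1) / real q * (real n)\<^sup>2 - real q \<le> 2 * real (ex_K n (q + 1))"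
proof -
  define E where "E = residue_graph q {..<n}"
  have sg: "sgraph {..<n} E" using residue_graph_subset by (auto simp: sgraph_def E_def)
  have "\<not> contains_K (q + 1) {..<n} E"
  proof
    assume "contains_K (q + 1) {..<n} E"
    then obtain K where K: "K \<subseteq> {..<n}" "card K = q + 1" "clique K E"
      by (auto simp: contains_K_def)
    have "finite K" using K(1) finite_subset by blast
    then have "card K \<le> q"
      by (rule card_residue_clique[OF _ assms]) (use K(3) in \<open>auto simp: clique_def E_def residue_graph_iff\<close>)
    then show False using K(2) by simp
  qed
  then have "card E \<le> ex_K n (q + 1)"
    unfolding ex_K_def by (intro Max_ge[OF finite_ex_K_set]) (use sg in \<open>auto intro!: exI\<close>)
  moreover have "pairs E {..<n} {..<n} = 2 * card E"
    using sg pairs_eq_twice_card by (simp add: sgraph_def)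
  moreover have "(real q - 1) / real q * (real n)\<^sup>2 - real q \<le> real (pairs E {..<n} {..<n})"
    using residue_graph_pairs[OF assms(1), of E "{..<n}" 0 n]
    by (simp add: E_def residue_graph_iff atLeast0LessThan)
  ultimately show ?thesis by linarith
qed

lemma ex_K_le:
  assumes "q \<ge> 1"
  shows "2 * real (ex_K n (q + 1)) \<le> (real q - 1) / real q * (real n)\<^sup>2"
proof -
  have "ex_K n (q + 1) \<in> {card E | V E. sgraph V E \<and> card V = n \<and> \<not> contains_K (q + 1) V E}"
    unfolding ex_K_def by (rule Max_in[OF finite_ex_K_set ex_K_set_nonempty]) (use assms in simp)
  then obtain V E where VE: "ex_K n (q + 1) = card E" "sgraph V E" "card V = n" "\<not> contains_K (q + 1) V E"
    by blast
  then have "pairs E V V = 2 * card E" using pairs_eq_twice_card by (simp add: sgraph_def)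
  moreover have "{v} \<notin> E" for v using VE(2) by (auto simp: sgraph_def nsets_def)
  ultimately show ?thesis
    using turan_bound[of V E q] VE assms by (simp add: sgraph_def)
qed

section \<open>The extremal construction\<close>

lemma contains_K_mono: "contains_K q V E \<Longrightarrow> E \<subseteq> F \<Longrightarrow> contains_K q V F"
  unfolding contains_K_def clique_def by blast

text \<open>Deleting edges from a \<open>K\<^sub>q\<close>-free graph creates no saturating edge: putting a deleted edge back stays inside
the original graph, and any other new clique was already created in the original graph. Hence it is enough
to construct a graph with at least the required number of edges.\<close>

lemma min_saturating_le:
  assumes "sgraph V E" "card V = n" "m \<le> card E" "\<not> contains_K q V E"
  shows "min_saturating q n m \<le> num_saturating q V E"
proof -
  obtain F where F: "F \<subseteq> E" "card F = m"
    using assms(3) obtain_subset_with_card_n by metis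
  have sg: "sgraph V F" using assms(1) F(1) by (auto simp: sgraph_def)
  have free: "\<not> contains_K q V F" using assms(4) F(1) contains_K_mono by blast
  have "saturating_edges q V F \<subseteq> saturating_edges q V E"
  proof
    fix e assume e: "e \<in> saturating_edges q V F"
    then have K: "contains_K q V (insert e F)" "e \<in> [V]\<^bsup>2\<^esup>" by (auto simp: saturating_edges_def)
    have "e \<notin> E"
    proof
      assume "e \<in> E"
      then have "insert e F \<subseteq> E" using F(1) by simp
      then show False using K(1) assms(4) contains_K_mono by blast
    qed
    moreover have "contains_K q V (insert e E)"
      using K(1) by (rule contains_K_mono) (use F(1) in auto)
    ultimately show "e \<in> saturating_edges q V E" using K(2) by (simp add: saturating_edges_def)
  qed
  moreover have "finite (saturating_edges q V E)"
    by (rule finite_subset[OF _ finite_imp_finite_nsets[of V]])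
      (use assms(1) in \<open>auto simp: sgraph_def saturating_edges_def\<close>)
  ultimately have "num_saturating q V F \<le> num_saturating q V E"
    unfolding num_saturating_def by (rule card_mono[rotated])
  moreover have "min_saturating q n m \<le> num_saturating q V F"
    unfolding min_saturating_def
    by (rule Min_le[OF finite_min_saturating_set]) (use sg free assms(2) F(2) in blast)
  ultimately show ?thesis by simp
qed

text \<open>Among \<open>q * t\<close> consecutive numbers, two with the same residue lie in different blocks of length \<open>q\<close>.\<close>

lemma card_residue_class_window:
  fixes q u t c :: nat
  assumes "q \<ge> 1"
  shows "card {j \<in> {u..<u + q * t}. j mod q = c} \<le> t"
proof -
  have "card {j \<in> {u..<u + q * t}. j mod q = c} \<le> card {..<t}"
  proof (rule card_inj_on_le)
    show "inj_on (\<lambda>j. (j - u) div q) {j \<in> {u..<u + q * t}. j mod q = c}"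
    proof (rule inj_onI)
      fix i j
      assume ij: "i \<in> {j \<in> {u..<u + q * t}. j mod q = c}" "j \<in> {j \<in> {u..<u + q * t}. j mod q = c}"
        and div: "(i - u) div q = (j - u) div q"
      have "(i - u) mod q = (j - u) mod q"
        using ij
      proof (induction i j rule: linorder_wlog)
        case (le i j)
        then have "q dvd j - i" by (intro mod_eq_dvd_iff_nat[THEN iffD1]) auto
        moreover have "j - i = (j - u) - (i - u)" using le by auto
        ultimately have "(j - u) mod q = (i - u) mod q"
          using mod_eq_dvd_iff_nat[of "i - u" "j - u" q] le(1) by (simp only: diff_le_mono)
        then show ?case by simp
      qed auto
      then have "i - u = j - u" using div by (metis div_mult_mod_eq)
      then show "i = j" using ij by auto
    qed
    show "(\<lambda>j. (j - u) div q) ` {j \<in> {u..<u + q * t}. j mod q = c} \<subseteq> {..<t}"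
      using assms by (auto simp: less_mult_imp_div_less mult.commute)
  qed simp
  then show ?thesis by simp
qed

text \<open>The extremal construction. The vertices from \<open>u\<close> on carry a complete \<open>q\<close>-partite graph; the independent set
of the first \<open>u\<close> vertices is joined to a window of \<open>q * t\<close> vertices, that is, to exactly \<open>t\<close> vertices of each
class. The edges lost in the multipartite part are regained by the joins, and the window is
small enough to keep the saturating edges few.\<close>

definition witness_graph :: "nat \<Rightarrow> nat \<Rightarrow> nat \<Rightarrow> nat \<Rightarrow> nat set set" where
  "witness_graph q u t n =
     residue_graph q {u..<n} \<union> {{x, y} | x y. x \<in> {..<u} \<and> y \<in> {u..<u + q * t}}"

lemma witness_graph_iff:
  "{x, y} \<in> witness_graph q u t n \<longleftrightarrow>
     x \<in> {u..<n} \<and> y \<in> {u..<n} \<and> x mod q \<noteq> y mod q \<or>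
     x < u \<and> y \<in> {u..<u + q * t} \<or> y < u \<and> x \<in> {u..<u + q * t}"
proof -
  have "{x, y} \<in> {{x, y} | x y. x \<in> {..<u} \<and> y \<in> {u..<u + q * t}} \<longleftrightarrow>
      x < u \<and> y \<in> {u..<u + q * t} \<or> y < u \<and> x \<in> {u..<u + q * t}"
    unfolding mem_Collect_eq doubleton_eq_iff lessThan_iff by blast
  then show ?thesis unfolding witness_graph_def Un_iff residue_graph_iff by blast
qed

lemma sgraph_witness:
  assumes "u + q * t \<le> n"
  shows "sgraph {..<n} (witness_graph q u t n)"
proof -
  have "residue_graph q {u..<n} \<subseteq> [{..<n}]\<^bsup>2\<^esup>"
    using residue_graph_subset nsets_mono[of "{u..<n}" "{..<n}" 2] by fastforce
  moreover have "{x, y} \<in> [{..<n}]\<^bsup>2\<^esup>" if "x < u" "y \<in> {u..<u + q * t}" for x y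
    using that assms by (simp add: nsets_def)
  ultimately show ?thesis unfolding sgraph_def witness_graph_def by blast
qed

lemma card_witness_clique:
  assumes "finite K" "clique K (witness_graph q u t n)" "q \<ge> 1" "K \<inter> {..<u} = {}"
  shows "card K \<le> q"
proof (rule card_residue_clique[OF assms(1,3)])
  fix x y assume xy: "x \<in> K" "y \<in> K" "x \<noteq> y"
  then have "{x, y} \<in> witness_graph q u t n" using assms(2) by (simp add: clique_def)
  moreover have "\<not> x < u" "\<not> y < u" using xy assms(4) by auto
  ultimately show "x mod q \<noteq> y mod q" by (simp add: witness_graph_iff)
qed

lemma witness_clique_inter:
  assumes "clique K (witness_graph q u t n)" "x \<in> K" "y \<in> K" "x < u" "y < u"
  shows "x = y"
proof (rule ccontr)
  assume "x \<noteq> y"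
  then have "{x, y} \<in> witness_graph q u t n" using assms by (simp add: clique_def)
  then show False using assms(4,5) by (simp add: witness_graph_iff)
qed

text \<open>A clique with \<open>q + 1\<close> vertices cannot live in the \<open>q\<close> residue classes alone, so it contains one of the first
\<open>u\<close> vertices, and then all its other vertices lie in the window.\<close>

lemma witness_clique_meets:
  assumes "finite K" "clique K (witness_graph q u t n)" "q \<ge> 1" "card K = q + 1"
  obtains z where "z \<in> K" "z < u" "K - {z} \<subseteq> {u..<u + q * t}"
proof -
  have "K \<inter> {..<u} \<noteq> {}" using card_witness_clique[OF assms(1-3)] assms(4) by auto
  then obtain z where z: "z \<in> K" "z < u" by auto
  have "K - {z} \<subseteq> {u..<u + q * t}"
  proof
    fix y assume y: "y \<in> K - {z}"
    then have "{z, y} \<in> witness_graph q u t n" using z(1) assms(2) by (auto simp: clique_def)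
    moreover have "\<not> y < u" using witness_clique_inter[OF assms(2) z(1) _ z(2)] y by blast
    ultimately show "y \<in> {u..<u + q * t}" using z(2) by (auto simp: witness_graph_iff)
  qed
  then show thesis using z that by blast
qed

lemma witness_free:
  assumes "q \<ge> 1"
  shows "\<not> contains_K (q + 2) V (witness_graph q u t n)"
proof
  assume "contains_K (q + 2) V (witness_graph q u t n)"
  then obtain K where K: "card K = q + 2" "clique K (witness_graph q u t n)"
    by (auto simp: contains_K_def)
  have fin: "finite K" using K(1) by (metis card.infinite add_is_0 zero_neq_numeral)
  obtain z where z: "z \<in> K" "K \<inter> {..<u} \<subseteq> {z}"
  proof (cases "K \<inter> {..<u} = {}")
    case True
    obtain z where "z \<in> K" using K(1) by fastforce
    with True show thesis using that by blast
  next
    case False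
    then obtain z where "z \<in> K" "z < u" by auto
    then show thesis using that witness_clique_inter[OF K(2)] by blast
  qed
  have "card (K - {z}) \<le> q"
    by (rule card_witness_clique[OF _ clique_mono[OF K(2)] assms]) (use fin z in auto)
  then show False using K(1) z(1) fin by simp
qed

text \<open>In a \<open>q + 2\<close>-clique created by \<open>{x, y}\<close>, deleting \<open>x\<close> or \<open>y\<close> leaves a \<open>q + 1\<close>-clique of the graph, to which the
previous analysis applies. Both must use the same one of the first \<open>u\<close> vertices unless \<open>x\<close> and \<open>y\<close> are
themselves those two vertices; so either both ends lie below \<open>u\<close> or both lie in the window, and then they
share a residue because they are not adjacent.\<close>

lemma witness_saturating:
  assumes "q \<ge> 1" "u + q * t \<le> n"
    and sat: "{x, y} \<in> saturating_edges (q + 2) V (witness_graph q u t n)"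
  shows "x < u \<and> y < u \<or>
    x \<in> {u..<u + q * t} \<and> y \<in> {u..<u + q * t} \<and> x mod q = y mod q"
proof -
  let ?E = "witness_graph q u t n"
  have ne: "{x, y} \<notin> ?E" "x \<noteq> y"
    using sat by (auto simp: saturating_edges_def nsets_def)
  obtain K where K: "K \<subseteq> V" "card K = q + 2" "clique K (insert {x, y} ?E)"
    using sat by (auto simp: saturating_edges_def contains_K_def)
  have fin: "finite K" using K(2) by (metis card.infinite add_is_0 zero_neq_numeral)
  have "x \<in> K \<and> y \<in> K"
  proof (rule ccontr)
    assume "\<not> (x \<in> K \<and> y \<in> K)"
    then have "clique K ?E" using K(3) unfolding clique_def by (metis doubleton_eq_iff insertE)
    then show False using witness_free[OF assms(1), of K] K(2) contains_KI by blast
  qed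
  then have xy: "x \<in> K" "y \<in> K" by auto
  have cl: "clique (K - {x}) ?E" "clique (K - {y}) ?E"
    using K(3) unfolding clique_def by (metis DiffD1 DiffD2 doubleton_eq_iff insertE singletonI)+
  have cd: "card (K - {x}) = q + 1" "card (K - {y}) = q + 1" using xy K(2) fin by simp_all
  obtain z where z: "z \<in> K - {x}" "z < u" "K - {x} - {z} \<subseteq> {u..<u + q * t}"
    using witness_clique_meets[OF _ cl(1) assms(1) cd(1)] fin by blast
  obtain z' where z': "z' \<in> K - {y}" "z' < u" "K - {y} - {z'} \<subseteq> {u..<u + q * t}"
    using witness_clique_meets[OF _ cl(2) assms(1) cd(2)] fin by blast
  show ?thesis
  proof (cases "z = y")
    case True
    then have "z' = x" using z z' xy ne(2) by fastforce
    then show ?thesis using True z z' by blast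
  next
    case False
    then have y: "y \<in> {u..<u + q * t}" using z(3) xy ne(2) by blast
    have "z' = z" using z' z False by fastforce
    then have x: "x \<in> {u..<u + q * t}" using z' z(1) xy ne(2) by blast
    show ?thesis using x y ne(1) assms(2) by (auto simp: witness_graph_iff)
  qed
qed

section \<open>The upper bound\<close>

lemma num_witness_saturating:
  assumes "q \<ge> 1" "u + q * t \<le> n"
  shows "2 * num_saturating (q + 2) {..<n} (witness_graph q u t n) \<le> u * u + q * t * t"
proof -
  define S where "S = saturating_edges (q + 2) {..<n} (witness_graph q u t n)"
  have S: "S \<subseteq> [{..<n}]\<^bsup>2\<^esup>" by (auto simp: S_def saturating_edges_def)
  have sat: "x < u \<and> y < u \<or>
      x \<in> {u..<u + q * t} \<and> y \<in> {u..<u + q * t} \<and> x mod q = y mod q" if "{x, y} \<in> S" for x y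
    using witness_saturating[OF assms] that by (simp add: S_def)
  have "pairs S {..<u} {..<n} \<le> u * card {..<u}"
  proof (rule pairs_le_sum)
    fix v assume "v \<in> {..<u}"
    then have "nbrs S v {..<n} \<subseteq> {..<u}" using sat by (fastforce simp: nbrs_def)
    then show "card (nbrs S v {..<n}) \<le> u" using card_mono[of "{..<u}"] by fastforce
  qed
  moreover have "pairs S {u..<u + q * t} {..<n} \<le> t * card {u..<u + q * t}"
  proof (rule pairs_le_sum)
    fix v assume "v \<in> {u..<u + q * t}"
    then have "nbrs S v {..<n} \<subseteq> {j \<in> {u..<u + q * t}. j mod q = v mod q}"
      using sat by (fastforce simp: nbrs_def)
    then have "card (nbrs S v {..<n}) \<le> card {j \<in> {u..<u + q * t}. j mod q = v mod q}"
      by (rule card_mono[rotated]) simp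
    also have "\<dots> \<le> t" by (rule card_residue_class_window[OF assms(1)])
    finally show "card (nbrs S v {..<n}) \<le> t" .
  qed
  moreover have "pairs S {u + q * t..<n} {..<n} \<le> 0 * card {u + q * t..<n}"
  proof (rule pairs_le_sum)
    fix v assume "v \<in> {u + q * t..<n}"
    then have "nbrs S v {..<n} = {}" using sat by (fastforce simp: nbrs_def)
    then show "card (nbrs S v {..<n}) \<le> 0" by simp
  qed
  moreover have "{..<n} = {..<u} \<union> ({u..<u + q * t} \<union> {u + q * t..<n})"
    using assms(2) by auto
  then have "pairs S {..<n} {..<n} = pairs S {..<u} {..<n} + (pairs S {u..<u + q * t} {..<n}
      + pairs S {u + q * t..<n} {..<n})"
    using pairs_Un_left[of "{..<u}" "{u..<u + q * t} \<union> {u + q * t..<n}" S "{..<n}"]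
      pairs_Un_left[of "{u..<u + q * t}" "{u + q * t..<n}" S "{..<n}"] by fastforce
  ultimately have "pairs S {..<n} {..<n} \<le> u * u + q * t * t" by (simp add: algebra_simps)
  then show ?thesis
    using pairs_eq_twice_card[OF _ S] by (simp add: num_saturating_def S_def)
qed

lemma card_witness_graph:
  assumes "q \<ge> 1" "u + q * t \<le> n"
  shows "(real q - 1) / real q * (real n - real u)\<^sup>2 - real q + 2 * real u * (real q * real t)
    \<le> 2 * real (card (witness_graph q u t n))"
proof -
  define E where "E = witness_graph q u t n"
  define W where "W = {u..<n}"
  have un: "u \<le> n" using assms(2) by simp
  have V: "{..<n} = {..<u} \<union> W" "finite W" "{..<u} \<inter> W = {}" using un by (auto simp: W_def)
  have "card (nbrs E x W) = q * t" if "x < u" for x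
  proof -
    have "nbrs E x W = {u..<u + q * t}"
      using that assms(2) by (auto simp: nbrs_def E_def W_def witness_graph_iff)
    then show ?thesis by simp
  qed
  then have "pairs E {..<u} W = u * (q * t)" by (simp add: pairs_def)
  moreover have "nbrs E v W = nbrs (residue_graph q W) v W" if "v \<in> W" for v
    using that by (auto simp: nbrs_def E_def W_def witness_graph_iff residue_graph_iff)
  then have "pairs E W W = pairs (residue_graph q W) W W" by (simp add: pairs_def)
  moreover have "(real q - 1) / real q * (real (n - u))\<^sup>2 - real q \<le> real (pairs (residue_graph q W) W W)"
    using residue_graph_pairs[OF assms(1) residue_graph_iff, of u "n - u" W] un by (simp add: W_def)
  moreover have "2 * card E = pairs E {..<u} {..<u} + 2 * pairs E {..<u} W + pairs E W W"
    using pairs_eq_twice_card[of "{..<n}" E] sgraph_witness[OF assms(2)] V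
      pairs_square_Un[of "{..<u}" W E] assms(2) by (simp add: sgraph_def E_def)
  then have "real (2 * card E) = real (pairs E {..<u} {..<u} + 2 * pairs E {..<u} W + pairs E W W)"
    by (simp only:)
  ultimately show ?thesis using un by (simp add: E_def of_nat_diff)
qed

text \<open>The limiting density as a function of \<open>q = p - 1\<close>. With \<open>c = (q - 1)\<^sup>2 / q\<^sup>3\<close> it is \<open>2 c / (4 + c)\<close>, the minimum over
\<open>x\<close> of \<open>c/2 (1 - x/2)\<^sup>2 + x\<^sup>2/2\<close>; the minimum is attained where \<open>x\<close> equals the minimum itself.\<close>

definition sat_density :: "real \<Rightarrow> real" where
  "sat_density q = 2 * (q - 1)\<^sup>2 / (4 * q ^ 3 + (q - 1)\<^sup>2)"

lemma sat_density_bounds: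
  assumes "q \<ge> 2"
  shows "0 < sat_density q" "sat_density q \<le> 1 / (2 * q)"
proof -
  have pos: "4 * q ^ 3 + (q - 1)\<^sup>2 > 0" using assms by (intro add_pos_nonneg) auto
  then show "0 < sat_density q" using assms by (simp add: sat_density_def)
  have "(q - 1)\<^sup>2 \<le> q\<^sup>2" using assms by (intro power_mono) auto
  then have "4 * q * (q - 1)\<^sup>2 \<le> 4 * q * q\<^sup>2" using assms by (intro mult_left_mono) auto
  moreover have "4 * q * q\<^sup>2 = 4 * q ^ 3" by (simp add: power3_eq_cube power2_eq_square)
  moreover have "2 * (q - 1)\<^sup>2 * (2 * q) = 4 * q * (q - 1)\<^sup>2" by simp
  ultimately have "2 * (q - 1)\<^sup>2 * (2 * q) \<le> 4 * q ^ 3 + (q - 1)\<^sup>2"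
    using zero_le_power2[of "q - 1"] by linarith
  then show "sat_density q \<le> 1 / (2 * q)"
    using pos assms by (simp add: sat_density_def field_simps)
qed

text \<open>The two squares are twice the densities of saturating edges in the extremal construction, inside the first \<open>u\<close>
vertices and inside the window, when \<open>u\<close> is \<open>sat_density q * n\<close>.\<close>

lemma sat_density_eq:
  assumes "q \<ge> 2"
  shows "(sat_density q)\<^sup>2 + q * ((q - 1) / q * (1 - sat_density q / 2) / q)\<^sup>2 = 2 * sat_density q"
proof -
  define D where "D = 4 * q ^ 3 + (q - 1)\<^sup>2"
  have D: "D > 0" unfolding D_def using assms by (intro add_pos_nonneg) auto
  have s: "sat_density q = 2 * (q - 1)\<^sup>2 / D" by (simp add: sat_density_def D_def)
  have "1 - sat_density q / 2 = 4 * q ^ 3 / D"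
    unfolding s using D by (simp add: field_simps) (simp add: D_def)
  then have *: "(q - 1) / q * (1 - sat_density q / 2) / q = 4 * q * (q - 1) / D"
    using assms D by (simp add: power3_eq_cube)
  have "(2 * (q - 1)\<^sup>2)\<^sup>2 + q * (4 * q * (q - 1))\<^sup>2 = 4 * (q - 1)\<^sup>2 * D"
    by (simp add: D_def algebra_simps power2_eq_square power3_eq_cube)
  then have "((2 * (q - 1)\<^sup>2)\<^sup>2 + q * (4 * q * (q - 1))\<^sup>2) / D\<^sup>2 = 4 * (q - 1)\<^sup>2 / D"
    using D by (simp only: power2_eq_square[of D]) simp
  then show ?thesis unfolding * unfolding s by (simp add: power_divide add_divide_distrib)
qed

text \<open>The size \<open>u\<close> is the optimal density rounded up. The window size \<open>q * t\<close> is about \<open>a (n - u/2)\<close> with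
\<open>a = 1 - 1/q\<close>, the size at which the \<open>2 u q t\<close> ordered pairs gained balance the loss \<open>a (n\<^sup>2 - (n - u)\<^sup>2)\<close>; the extra
\<open>q + 2\<close> absorbs the bounded deficit of the multipartite part and the one additional edge.\<close>

lemma min_saturating_upper:
  fixes q :: nat
  assumes "q \<ge> 2" "n \<ge> 2 * q * (3 * q + 1)"
  shows "real (min_saturating (q + 2) n (ex_K n (q + 1) + 1))
    \<le> sat_density (real q) * (real n)\<^sup>2 + (5 * real q + 5) * real n"
proof -
  define s where "s = sat_density (real q)"
  define a where "a = (real q - 1) / real q"
  define \<tau> where "\<tau> = a * (1 - s / 2) / real q"
  define u where "u = nat \<lceil>s * real n\<rceil>"
  define t where "t = nat \<lceil>(a * (1 - s / 2) * real n + real q + 2) / real q\<rceil>"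
  have q: "real q \<ge> 2" using assms(1) by simp
  have "0 < 2 * q * (3 * q + 1)" using assms(1) by simp
  then have n1: "n \<ge> 1" using assms(2) by linarith
  have s: "0 < s" "s \<le> 1 / (2 * real q)" using sat_density_bounds[OF q] by (simp_all add: s_def)
  have "1 / (2 * real q) \<le> 1 / 4" using q by (intro divide_left_mono) auto
  then have s4: "s \<le> 1 / 4" using s by linarith
  have a: "0 \<le> a" "a \<le> 1" "a = 1 - 1 / real q" using q by (simp_all add: a_def field_simps)
  have as: "0 \<le> a * (1 - s / 2)" "a * (1 - s / 2) \<le> a"
    using a s s4 by (simp_all add: mult_left_le)
  have sn: "0 < s * real n" using s n1 by simp
  have u: "s * real n \<le> real u" "real u \<le> s * real n + 1" "real u \<ge> 0"
    using sn unfolding u_def by linarith+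
  have "u \<noteq> 0" using u(1) sn by (metis less_le_not_le of_nat_0)
  then have u1: "real u \<ge> 1" by simp
  have "0 \<le> (a * (1 - s / 2) * real n + real q + 2) / real q" using as by simp
  then have t: "(a * (1 - s / 2) * real n + real q + 2) / real q \<le> real t"
      "real t \<le> (a * (1 - s / 2) * real n + real q + 2) / real q + 1"
    unfolding t_def by linarith+
  have qt: "a * (1 - s / 2) * real n + real q + 2 \<le> real q * real t"
    using t(1) q by (simp add: pos_divide_le_eq mult.commute)
  have "real q / real q = 1" "2 / real q \<le> 1" using q by simp_all
  then have t3: "real t \<le> \<tau> * real n + 3"
    using t(2) unfolding \<tau>_def add_divide_distrib times_divide_eq_left by linarith
  have q\<tau>: "real q * \<tau> = a * (1 - s / 2)" using q by (simp add: \<tau>_def)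
  have "real q * real t \<le> real q * (\<tau> * real n + 3)" using t3 by (intro mult_left_mono) auto
  also have "\<dots> = a * (1 - s / 2) * real n + 3 * real q"
    by (simp add: distrib_left flip: q\<tau>)
  also have "\<dots> \<le> a * real n + 3 * real q"
    using as(2) by (intro add_right_mono mult_right_mono) auto
  finally have qt2: "real q * real t \<le> a * real n + 3 * real q" .
  \<comment> \<open>The witness fits into \<open>n\<close> vertices: together \<open>u\<close> and \<open>q * t\<close> take at most \<open>(1 - 1/(2q)) n + 3 q + 1\<close>.\<close>
  have "s * real n \<le> 1 / (2 * real q) * real n" using s by (intro mult_right_mono) auto
  then have "real u + real q * real t
      \<le> 1 / (2 * real q) * real n + 1 + ((1 - 1 / real q) * real n + 3 * real q)"
    using u(2) qt2 unfolding a(3) by linarith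
  also have "\<dots> = real n - (real n / (2 * real q) - (3 * real q + 1))"
    using q by (simp add: field_simps)
  also have "\<dots> \<le> real n"
  proof -
    have "real (2 * q * (3 * q + 1)) \<le> real n" using assms(2) of_nat_le_iff by blast
    then have "3 * real q + 1 \<le> real n / (2 * real q)" using q by (simp add: field_simps)
    then show ?thesis by simp
  qed
  finally have "real (u + q * t) \<le> real n" by simp
  then have fit: "u + q * t \<le> n" using of_nat_le_iff by blast
  define E where "E = witness_graph q u t n"
  \<comment> \<open>The witness has more than \<open>a n\<^sup>2\<close> ordered pairs, hence more edges than any \<open>K\<^sub>q\<^sub>+\<^sub>1\<close>-free graph.\<close>
  have "a * (1 - s / 2) * real n = a * (real n - s * real n / 2)" by (simp add: algebra_simps)
  moreover have "a * (real n - real u / 2) \<le> a * (real n - s * real n / 2)"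
    using u(1) a(1) by (intro mult_left_mono) auto
  ultimately have "a * (real n - real u / 2) + real q + 2 \<le> real q * real t" using qt by linarith
  then have "2 * real u * (a * (real n - real u / 2) + (real q + 2)) \<le> 2 * real u * (real q * real t)"
    by (intro mult_left_mono) auto
  moreover have "a * (real n - real u)\<^sup>2 + 2 * real u * (a * (real n - real u / 2)) = a * (real n)\<^sup>2"
    by (simp add: power2_eq_square algebra_simps)
  moreover have "2 * (real q + 2) \<le> 2 * real u * (real q + 2)"
    using mult_right_mono[OF u1, of "2 * (real q + 2)"] by (simp add: mult.assoc mult.left_commute)
  moreover have "a * (real n - real u)\<^sup>2 - real q + 2 * real u * (real q * real t) \<le> 2 * real (card E)"
    using card_witness_graph[OF _ fit] assms(1) by (simp add: a_def E_def)
  ultimately have "a * (real n)\<^sup>2 + 2 \<le> 2 * real (card E)"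
    using q by (simp only: distrib_left)
  moreover have "2 * real (ex_K n (q + 1)) \<le> a * (real n)\<^sup>2"
    using ex_K_le[of q n] assms(1) by (simp add: a_def)
  ultimately have "real (ex_K n (q + 1) + 1) \<le> real (card E)" by simp
  then have edges: "ex_K n (q + 1) + 1 \<le> card E" using of_nat_le_iff by blast
  have "min_saturating (q + 2) n (ex_K n (q + 1) + 1) \<le> num_saturating (q + 2) {..<n} E"
    using edges sgraph_witness[OF fit] witness_free[of q] assms(1)
    by (intro min_saturating_le) (auto simp: E_def)
  then have "2 * min_saturating (q + 2) n (ex_K n (q + 1) + 1) \<le> u * u + q * t * t"
    using num_witness_saturating[OF _ fit] assms(1) by (simp add: E_def)
  then have "real (2 * min_saturating (q + 2) n (ex_K n (q + 1) + 1)) \<le> real (u * u + q * t * t)"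
    using of_nat_le_iff by blast
  then have "2 * real (min_saturating (q + 2) n (ex_K n (q + 1) + 1)) \<le> (real u)\<^sup>2 + real q * (real t)\<^sup>2"
    by (simp add: power2_eq_square mult.assoc)
  also have "\<dots> \<le> (s * real n + 1)\<^sup>2 + real q * (\<tau> * real n + 3)\<^sup>2"
    using u t3 by (intro add_mono mult_left_mono power_mono) auto
  also have "\<dots> = (s\<^sup>2 + real q * \<tau>\<^sup>2) * (real n)\<^sup>2 + (2 * s + 6 * (real q * \<tau>)) * real n + (1 + 9 * real q)"
    by (simp add: power2_eq_square algebra_simps)
  also have "s\<^sup>2 + real q * \<tau>\<^sup>2 = 2 * s"
    using sat_density_eq[OF q] by (simp add: s_def \<tau>_def a_def)
  also have "2 * s * (real n)\<^sup>2 + (2 * s + 6 * (real q * \<tau>)) * real n + (1 + 9 * real q)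
      \<le> 2 * s * (real n)\<^sup>2 + 8 * real n + (1 + 9 * real q) * real n"
  proof -
    have 1: "(2 * s + 6 * (real q * \<tau>)) * real n \<le> 8 * real n"
      using s4 as a(2) unfolding q\<tau> by (intro mult_right_mono) auto
    have "(1 + 9 * real q) * 1 \<le> (1 + 9 * real q) * real n"
      using n1 by (intro mult_left_mono) auto
    then have 2: "1 + 9 * real q \<le> (1 + 9 * real q) * real n" by simp
    show ?thesis by (rule add_mono[OF add_mono[OF order_refl 1] 2])
  qed
  also have "\<dots> \<le> 2 * (s * (real n)\<^sup>2 + (5 * real q + 5) * real n)"
    by (simp add: algebra_simps)
  finally show ?thesis by (simp add: s_def)
qed

section \<open>Clique packings and saturating edges\<close>

lemma pairs_Union:
  assumes "finite P" "\<And>T. T \<in> P \<Longrightarrow> finite T" "pairwise disjnt P"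
  shows "pairs E A (\<Union>P) = (\<Sum>T\<in>P. pairs E A T)"
proof -
  have "card (nbrs E v (\<Union>P)) = (\<Sum>T\<in>P. card (nbrs E v T))" for v
  proof -
    have "nbrs E v (\<Union>P) = (\<Union>T\<in>P. nbrs E v T)" by (auto simp: nbrs_def)
    also have "card \<dots> = (\<Sum>T\<in>P. card (nbrs E v T))"
    proof (rule card_UN_disjoint)
      show "\<forall>S\<in>P. \<forall>T\<in>P. S \<noteq> T \<longrightarrow> nbrs E v S \<inter> nbrs E v T = {}"
        using assms(3) unfolding pairwise_def disjnt_def nbrs_def by blast
    qed (use assms in auto)
    finally show ?thesis .
  qed
  then have "pairs E A (\<Union>P) = (\<Sum>v\<in>A. \<Sum>T\<in>P. card (nbrs E v T))" by (simp add: pairs_def)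
  also have "\<dots> = (\<Sum>T\<in>P. pairs E A T)" unfolding pairs_def by (rule sum.swap)
  finally show ?thesis .
qed

locale clique_free_graph =
  fixes V :: "nat set" and E :: "nat set set" and p :: nat
  assumes graph: "sgraph V E" and free: "\<not> contains_K (p + 1) V E" and p2: "p \<ge> 2"
begin

definition S :: "nat set set" where
  "S = saturating_edges (p + 1) V E"

text \<open>Since the graph is \<open>K\<^sub>p\<^sub>+\<^sub>1\<close>-free, these are its largest possible cliques.\<close>

definition Kp :: "nat set \<Rightarrow> bool" where
  "Kp T \<longleftrightarrow> T \<subseteq> V \<and> card T = p \<and> clique T E"

definition packing :: "nat set set \<Rightarrow> bool" where
  "packing P \<longleftrightarrow> (\<forall>T\<in>P. Kp T) \<and> pairwise disjnt P"

lemma finite_V: "finite V"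
  using graph by (simp add: sgraph_def)

lemma no_loop: "{v} \<notin> E"
  using graph by (auto simp: sgraph_def nsets_def)

lemma finite_Kp: "Kp T \<Longrightarrow> finite T"
  using finite_V finite_subset by (auto simp: Kp_def)

lemma Kp_nonempty: "Kp T \<Longrightarrow> T \<noteq> {}"
  using p2 by (auto simp: Kp_def)

lemma card_nbrs_Kp_le:
  assumes "Kp K" "v \<in> V"
  shows "card (nbrs E v K) \<le> p - 1"
  using card_nbrs_clique_le[OF free no_loop] assms finite_Kp by (simp add: Kp_def)

lemma nbrs_Kp_cases:
  assumes "Kp K" "v \<in> V"
  obtains "card (nbrs E v K) \<le> p - 2"
  | x where "card (nbrs E v K) = p - 1" "x \<in> K" "nbrs E v K = K - {x}"
proof (cases "card (nbrs E v K) \<le> p - 2")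
  case True
  then show thesis by (rule that(1))
next
  case False
  then have c: "card (nbrs E v K) = p - 1" using card_nbrs_Kp_le[OF assms] p2 by simp
  then have "card (K - nbrs E v K) = 1"
    using assms(1) finite_Kp[OF assms(1)] p2 nbrs_subset[of E v K]
    by (simp add: card_Diff_subset Kp_def)
  then obtain x where x: "K - nbrs E v K = {x}" by (auto simp: card_1_singleton_iff)
  then have "nbrs E v K = K - {x}" using nbrs_subset[of E v K] by blast
  with c x show thesis using that(2) by blast
qed

text \<open>Two \<open>p\<close>-cliques sharing \<open>p - 1\<close> vertices: their two tips are not adjacent, and joining them creates a
\<open>p + 1\<close>-clique. All saturating edges of the lower bound arise this way.\<close>

lemma saturating_pair:
  assumes "v \<in> V" "w \<in> V" "v \<noteq> w" "Q \<subseteq> V" "card Q = p - 1" "clique Q E"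
    and "\<And>x. x \<in> Q \<Longrightarrow> {v, x} \<in> E" "\<And>x. x \<in> Q \<Longrightarrow> {w, x} \<in> E"
  shows "{v, w} \<in> S"
proof -
  let ?L = "insert v (insert w Q)"
  have "finite Q" using assms(4) finite_V finite_subset by blast
  moreover have "v \<notin> Q" "w \<notin> Q" using assms(7,8) no_loop by fastforce+
  ultimately have L: "card ?L = p + 1" "?L \<subseteq> V" using assms(1-5) p2 by simp_all
  have "{v, w} \<notin> E"
  proof
    assume "{v, w} \<in> E"
    then have "clique ?L E"
      by (intro clique_insert assms(6)) (use assms(7,8) in auto)
    then show False using free contains_KI[OF L(2,1)] by blast
  qed
  moreover have "clique ?L (insert {v, w} E)"
    by (intro clique_insert) (use assms(6-8) in \<open>auto simp: clique_def\<close>)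
  ultimately show ?thesis
    using contains_KI[OF L(2,1)] assms(1-3) by (auto simp: S_def saturating_edges_def nsets_def)
qed

lemma Kp_minus_adj:
  assumes "Kp K" "x \<in> K"
  shows "K - {x} \<subseteq> V" "card (K - {x}) = p - 1" "clique (K - {x}) E"
    and "\<And>y. y \<in> K - {x} \<Longrightarrow> {x, y} \<in> E"
  using assms finite_Kp[OF assms(1)] clique_mono[of K E "K - {x}"]
  by (auto simp: Kp_def clique_def)

text \<open>Edges beyond the first \<open>p - 2\<close> are paid for by saturating edges: a vertex outside \<open>K\<close> that sees all of \<open>K\<close> but one
vertex \<open>x\<close> forms a saturating edge with \<open>x\<close>.\<close>

lemma card_nbrs_Kp_saturating:
  assumes "Kp K" "v \<in> V"
  shows "card (nbrs E v K) \<le> (p - 2) + card (nbrs S v K) + of_bool (v \<in> K)"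
  using assms
proof (cases rule: nbrs_Kp_cases)
  case (2 x)
  show ?thesis
  proof (cases "v \<in> K")
    case False
    have "{v, x} \<in> S"
      by (rule saturating_pair[where Q = "K - {x}"])
        (use assms 2 False Kp_minus_adj[OF assms(1) 2(2)] in \<open>auto simp: Kp_def nbrs_def\<close>)
    then have "x \<in> nbrs S v K" using 2(2) by (simp add: nbrs_def)
    then have "card (nbrs S v K) > 0"
      using finite_Kp[OF assms(1)] by (auto simp: card_gt_0_iff)
    then show ?thesis using 2(1) by simp
  qed (use 2 in simp)
qed simp

lemma pairs_Kp_le:
  assumes "Kp K" "A \<subseteq> V"
  shows "pairs E A K \<le> (p - 2) * card A + pairs S A K + card (A \<inter> K)"
proof -
  have fin: "finite A" using assms(2) finite_V finite_subset by blast
  have "pairs E A K \<le> (\<Sum>v\<in>A. (p - 2) + card (nbrs S v K) + of_bool (v \<in> K))"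
    unfolding pairs_def using assms(2)
    by (intro sum_mono card_nbrs_Kp_saturating[OF assms(1)]) blast
  also have "\<dots> = (p - 2) * card A + pairs S A K + card (A \<inter> K)"
    using fin by (simp add: sum.distrib pairs_def)
  finally show ?thesis .
qed

lemma packing_finite:
  assumes "packing P"
  shows "finite P" "\<And>T. T \<in> P \<Longrightarrow> finite T" "pairwise disjnt P" "\<Union>P \<subseteq> V"
proof -
  show V: "\<Union>P \<subseteq> V" using assms by (auto simp: packing_def Kp_def)
  then show "finite P" using finite_V by (meson finite_UnionD finite_subset)
qed (use assms finite_Kp in \<open>auto simp: packing_def\<close>)

lemma card_packing:
  assumes "packing P"
  shows "card (\<Union>P) = card P * p"
  using card_Union_disjoint[of P] packing_finite[OF assms] assms
  by (simp add: packing_def Kp_def)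

lemma pairs_packing_le:
  assumes "packing P" "A \<subseteq> V"
  shows "pairs E A (\<Union>P) \<le> card P * ((p - 2) * card A) + pairs S A (\<Union>P) + card (A \<inter> \<Union>P)"
proof -
  note fin = packing_finite[OF assms(1)]
  have "pairs E A (\<Union>P) = (\<Sum>T\<in>P. pairs E A T)" using pairs_Union fin by blast
  also have "\<dots> \<le> (\<Sum>T\<in>P. (p - 2) * card A + pairs S A T + card (A \<inter> T))"
    using pairs_Kp_le assms by (intro sum_mono) (auto simp: packing_def)
  also have "\<dots> = card P * ((p - 2) * card A) + pairs S A (\<Union>P) + (\<Sum>T\<in>P. card (A \<inter> T))"
    using pairs_Union[OF fin(1-3)] by (simp add: sum.distrib)
  also have "(\<Sum>T\<in>P. card (A \<inter> T)) = card (\<Union>T\<in>P. A \<inter> T)"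
    using fin by (intro card_UN_disjoint[symmetric]) (auto simp: pairwise_def disjnt_def)
  also have "(\<Union>T\<in>P. A \<inter> T) = A \<inter> \<Union>P" by blast
  finally show ?thesis .
qed

lemma pairs_packing_le_trivial:
  assumes "packing P" "A \<subseteq> V"
  shows "pairs E A (\<Union>P) \<le> card P * ((p - 1) * card A)"
proof -
  have "pairs E A (\<Union>P) = (\<Sum>T\<in>P. pairs E A T)" using pairs_Union packing_finite[OF assms(1)] by blast
  also have "\<dots> \<le> (\<Sum>T\<in>P. (p - 1) * card A)"
    using card_nbrs_Kp_le assms by (intro sum_mono pairs_le_sum) (auto simp: packing_def)
  finally show ?thesis by simp
qed

text \<open>Two criteria, in this order: the number of cliques, then the number of edges that the packing leaves uncovered.
The first makes the remainder \<open>K\<^sub>p\<close>-free, so that the Turan bound applies to it; the second makes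
exchanges between a packed clique and the remainder favourable.\<close>

definition optimal_packing :: "nat set set \<Rightarrow> bool" where
  "optimal_packing P \<longleftrightarrow> packing P \<and> (\<forall>P'. packing P' \<longrightarrow> card P' \<le> card P) \<and>
     (\<forall>P'. packing P' \<and> card P' = card P \<longrightarrow>
        pairs E (V - \<Union>P') (V - \<Union>P') \<le> pairs E (V - \<Union>P) (V - \<Union>P))"

lemma optimal_packing_exists: "\<exists>P. optimal_packing P"
proof -
  have "packing {}" by (simp add: packing_def)
  moreover have "card P < Suc (card (Pow V))" if "packing P" for P
  proof -
    have "P \<subseteq> Pow V" using packing_finite(4)[OF that] by blast
    then show ?thesis using finite_V by (simp add: card_mono less_Suc_eq_le del: card_Pow)
  qed
  ultimately obtain P0 where P0: "packing P0" "\<And>P'. packing P' \<Longrightarrow> card P' \<le> card P0"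
    using ex_has_greatest_nat[of packing "{}" card "Suc (card (Pow V))"] by blast
  have "pairs E (V - \<Union>P') (V - \<Union>P') < Suc (card V * card V)" for P'
  proof -
    have "pairs E (V - \<Union>P') (V - \<Union>P') \<le> card (V - \<Union>P') * card (V - \<Union>P')"
      using pairs_le_mult finite_V by blast
    also have "\<dots> \<le> card V * card V" using finite_V by (intro mult_le_mono card_mono) auto
    finally show ?thesis by simp
  qed
  then obtain P where "packing P \<and> card P = card P0"
    "\<forall>P'. packing P' \<and> card P' = card P0 \<longrightarrow>
        pairs E (V - \<Union>P') (V - \<Union>P') \<le> pairs E (V - \<Union>P) (V - \<Union>P)"
    using ex_has_greatest_nat[of "\<lambda>P. packing P \<and> card P = card P0" P0
        "\<lambda>P. pairs E (V - \<Union>P) (V - \<Union>P)" "Suc (card V * card V)"] P0(1) by blast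
  then show ?thesis using P0(2) by (auto simp: optimal_packing_def)
qed

lemma remainder_Kp_free:
  assumes "optimal_packing P"
  shows "\<not> contains_K p (V - \<Union>P) E"
proof
  assume "contains_K p (V - \<Union>P) E"
  then obtain K where K: "K \<subseteq> V - \<Union>P" "card K = p" "clique K E" by (auto simp: contains_K_def)
  then have "Kp K" by (auto simp: Kp_def)
  have P: "packing P" using assms by (simp add: optimal_packing_def)
  have "packing (insert K P)"
    using K(1) P \<open>Kp K\<close> by (auto simp: packing_def pairwise_insert disjnt_def)
  moreover have "K \<notin> P" using K(1) Kp_nonempty[OF \<open>Kp K\<close>] by blast
  then have "card (insert K P) = Suc (card P)" using packing_finite(1)[OF P] by simp
  ultimately show False using assms unfolding optimal_packing_def by fastforce
qed

text \<open>The crucial step. A packed clique \<open>T\<close> may have vertices of the remainder \<open>R\<close> missing each of its \<open>p\<close> vertices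
in turn; spread evenly over \<open>p\<close> classes they would force too few saturating edges. Among the
\<open>p\<close>-cliques inside \<open>R \<union> T\<close>, one with as many vertices in \<open>R\<close> as possible avoids this: it keeps a vertex \<open>t\<close> of \<open>T\<close>
because \<open>R\<close> is \<open>K\<^sub>p\<close>-free, and no vertex of \<open>R\<close> is complete to \<open>K - {t}\<close>, since it could replace \<open>t\<close>. Trading
\<open>T\<close> for \<open>K\<close> gives a packing of the same size, so by optimality it does not increase the edges
in the remainder: up to a constant, the vertices of \<open>K\<close> have at least as many edges into \<open>R\<close> as those of \<open>T\<close>.\<close>

lemma exchange_clique:
  assumes opt: "optimal_packing P" and T: "T \<in> P"
  defines "R \<equiv> V - \<Union>P"
  obtains K t where "Kp K" "t \<in> K" "\<And>w. w \<in> R \<Longrightarrow> \<exists>x\<in>K - {t}. {w, x} \<notin> E"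
    and "pairs E R T \<le> pairs E R K + 2 * p\<^sup>2"
proof -
  have P: "packing P" using opt by (simp add: optimal_packing_def)
  have R: "finite R" "R \<subseteq> V" "R \<inter> T = {}" using finite_V T by (auto simp: R_def)
  have KT: "Kp T" using P T by (simp add: packing_def)
  obtain K where K: "Kp K" "K \<subseteq> R \<union> T"
    and Kmax: "\<And>K'. Kp K' \<Longrightarrow> K' \<subseteq> R \<union> T \<Longrightarrow> card (K' \<inter> R) \<le> card (K \<inter> R)"
  proof -
    have "\<forall>K. Kp K \<and> K \<subseteq> R \<union> T \<longrightarrow> card (K \<inter> R) < Suc (card R)"
      using R(1) by (auto simp: less_Suc_eq_le intro: card_mono)
    then show thesis
      using ex_has_greatest_nat[of "\<lambda>K. Kp K \<and> K \<subseteq> R \<union> T" T "\<lambda>K. card (K \<inter> R)" "Suc (card R)"]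
        KT that by blast
  qed
  have finK: "finite K" "finite T" using finite_Kp K(1) KT by auto
  define A where "A = R - K"
  define B where "B = K \<inter> R"
  define C where "C = T - K"
  define D where "D = T \<inter> K"
  have fin: "finite A" "finite B" "finite C" "finite D"
    using R(1) finK by (auto simp: A_def B_def C_def D_def)
  have split: "R = A \<union> B" "A \<inter> B = {}" "T = C \<union> D" "C \<inter> D = {}" "K = B \<union> D" "B \<inter> D = {}" "A \<inter> C = {}"
    using K(2) R(3) by (auto simp: A_def B_def C_def D_def)
  have "card K = card B + card D" "card T = card C + card D"
    using fin split by (simp_all add: card_Un_disjoint)
  then have card_BC: "card B \<le> p" "card C \<le> p"
    using K(1) KT by (auto simp: Kp_def)
  have other: "K \<inter> T' = {}" if "T' \<in> P - {T}" for T'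
  proof -
    have "T \<inter> T' = {}" using P T that by (auto simp: packing_def pairwise_def disjnt_def)
    then show ?thesis using that K(2) by (auto simp: R_def)
  qed
  \<comment> \<open>\<open>T\<close> is exchanged for \<open>K\<close> in the packing; the new remainder arises from \<open>R\<close> by removing \<open>B\<close> and adding \<open>C\<close>.\<close>
  define P' where "P' = insert K (P - {T})"
  have pP': "packing P'"
    using P K(1) other by (auto simp: P'_def packing_def pairwise_insert disjnt_def pairwise_def)
  have "K \<notin> P - {T}" using other[of K] Kp_nonempty[OF K(1)] by blast
  then have cP': "card P' = card P"
    using packing_finite(1)[OF P] card_Suc_Diff1[OF packing_finite(1)[OF P] T]
    by (simp add: P'_def del: card_Diff_insert card_Diff_singleton)
  have "T' \<inter> T = {}" if "T' \<in> P - {T}" for T'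
    using P T that by (auto simp: packing_def pairwise_def disjnt_def)
  then have R': "V - \<Union>P' = A \<union> C"
    using R(2) KT T K(2) by (auto simp: P'_def R_def A_def C_def Kp_def)
  have "pairs E (A \<union> C) (A \<union> C) \<le> pairs E (A \<union> B) (A \<union> B)"
    using opt pP' cP' R' split(1) unfolding optimal_packing_def R_def by metis
  then have "2 * pairs E A C \<le> 2 * pairs E A B + pairs E B B"
    using pairs_square_Un[of A C E] pairs_square_Un[of A B E] fin split by simp
  moreover have "pairs E B B \<le> p * p" "pairs E B C \<le> p * p"
    using pairs_le_mult[OF fin(2), of E B] pairs_le_mult[OF fin(3), of E B]
      mult_le_mono[OF card_BC(1,1)] mult_le_mono[OF card_BC] by simp_all
  moreover have "pairs E R T = pairs E A C + pairs E B C + pairs E R D"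
    using fin split by (simp add: pairs_Un_left pairs_Un_right)
  moreover have "pairs E R K = pairs E A B + pairs E B B + pairs E R D"
    using fin split by (simp add: pairs_Un_left pairs_Un_right)
  ultimately have bound: "pairs E R T \<le> pairs E R K + 2 * p\<^sup>2"
    by (simp add: power2_eq_square)
  have "\<not> K \<subseteq> R"
    using remainder_Kp_free[OF opt] K(1) contains_KI[of K R p E] by (auto simp: R_def Kp_def)
  then obtain t where t: "t \<in> K" "t \<notin> R" by blast
  have "\<exists>x\<in>K - {t}. {w, x} \<notin> E" if w: "w \<in> R" for w
  proof (rule ccontr)
    assume "\<not> ?thesis"
    then have adj: "\<And>x. x \<in> K - {t} \<Longrightarrow> {w, x} \<in> E" by blast
    then have wK: "w \<notin> K - {t}" using no_loop by fastforce
    define K' where "K' = insert w (K - {t})"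
    have "Kp K'"
      using clique_insert[OF Kp_minus_adj(3)[OF K(1) t(1)] adj] Kp_minus_adj[OF K(1) t(1)]
        wK w R(2) finK(1) p2 by (auto simp: Kp_def K'_def)
    moreover have "K' \<subseteq> R \<union> T" using K(2) w by (auto simp: K'_def)
    moreover have "K' \<inter> R = insert w (K \<inter> R)" using w t(2) by (auto simp: K'_def)
    moreover have "w \<notin> K \<inter> R" using wK w t(2) by blast
    ultimately show False using Kmax[of K'] finK(1) by simp
  qed
  then show thesis using that[OF K(1) t(1) _ bound] by blast
qed

text \<open>Sort the vertices of \<open>R\<close> that see \<open>p - 1\<close> vertices of \<open>K\<close> by the vertex \<open>x\<close> they miss. Two vertices in the same
class have the \<open>p - 1\<close>-clique \<open>K - {x}\<close> in common, so each class consists of pairwise saturating pairs. The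
hypothesis on \<open>t\<close> empties one class, and convexity over the other \<open>p - 1\<close> gives \<open>\<rho>\<^sup>2 / (p - 1)\<close>
ordered pairs, where \<open>\<rho>\<close> is the number of sorted vertices.\<close>

lemma saturating_pairs_inside:
  assumes K: "Kp K" and R: "R \<subseteq> V" and t: "t \<in> K" "\<And>w. w \<in> R \<Longrightarrow> \<exists>x\<in>K - {t}. {w, x} \<notin> E"
  obtains \<rho> :: real where "0 \<le> \<rho>" "\<rho> \<le> real (card R)"
    and "real (pairs E R K) \<le> (real p - 2) * real (card R) + \<rho>"
    and "\<rho>\<^sup>2 / (real p - 1) - \<rho> \<le> real (pairs S R R)"
proof -
  define X where "X x = {w \<in> R. nbrs E w K = K - {x}}" for x
  define J where "J = K - {t}"
  define r where "r = (\<Sum>x\<in>J. card (X x))"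
  have finR: "finite R" using R finite_V finite_subset by blast
  have finX: "finite (X x)" for x using finR by (simp add: X_def)
  have finJ: "finite J" "card J = p - 1" "J \<subseteq> K"
    using finite_Kp[OF K] Kp_minus_adj(2)[OF K t(1)] by (auto simp: J_def)
  have disj: "\<forall>x\<in>J. \<forall>y\<in>J. x \<noteq> y \<longrightarrow> X x \<inter> X y = {}"
    using finJ(3) by (auto simp: X_def)
  have "r = card (\<Union>x\<in>J. X x)"
    unfolding r_def using finX finJ(1) disj by (intro card_UN_disjoint[symmetric]) auto
  also have "\<dots> \<le> card R" by (rule card_mono[OF finR]) (auto simp: X_def)
  finally have r_le: "r \<le> card R" .
  have "pairs E R K \<le> (\<Sum>w\<in>R. (p - 2) + (\<Sum>x\<in>J. of_bool (w \<in> X x)))"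
    unfolding pairs_def
  proof (rule sum_mono)
    fix w assume w: "w \<in> R"
    then have "w \<in> V" using R by blast
    with K show "card (nbrs E w K) \<le> (p - 2) + (\<Sum>x\<in>J. of_bool (w \<in> X x))"
    proof (cases rule: nbrs_Kp_cases)
      case (2 x)
      have "x \<noteq> t" using t(2)[OF w] 2(3) by (auto simp: nbrs_def)
      then have x: "x \<in> J" "w \<in> X x" using 2 w by (auto simp: J_def X_def)
      then have "of_bool (w \<in> X x) \<le> (\<Sum>x\<in>J. of_bool (w \<in> X x) :: nat)"
        by (intro member_le_sum finJ) auto
      then show ?thesis using 2(1) x(2) by simp
    qed simp
  qed
  also have "\<dots> = (p - 2) * card R + (\<Sum>x\<in>J. \<Sum>w\<in>R. of_bool (w \<in> X x))"
    by (simp add: sum.distrib sum.swap[of _ J R])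
  also have "(\<Sum>x\<in>J. \<Sum>w\<in>R. of_bool (w \<in> X x)) = r"
  proof -
    have "R \<inter> X x = X x" for x by (auto simp: X_def)
    then show ?thesis unfolding r_def using finR by simp
  qed
  finally have "real (pairs E R K) \<le> real ((p - 2) * card R + r)" by (simp only: of_nat_le_iff)
  then have deg: "real (pairs E R K) \<le> (real p - 2) * real (card R) + real r"
    using p2 by (simp add: of_nat_diff)
  have "(\<Sum>x\<in>J. card (X x) * (card (X x) - 1)) \<le> (\<Sum>x\<in>J. \<Sum>w\<in>X x. card (nbrs S w R))"
  proof (rule sum_mono)
    fix x assume "x \<in> J"
    then have x: "x \<in> K" using finJ(3) by blast
    have "card (X x) - 1 \<le> card (nbrs S w R)" if w: "w \<in> X x" for w
    proof -
      have "X x - {w} \<subseteq> nbrs S w R"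
      proof
        fix w' assume w': "w' \<in> X x - {w}"
        have "{w, w'} \<in> S"
          by (rule saturating_pair[where Q = "K - {x}"])
            (use w w' R Kp_minus_adj[OF K x] in \<open>auto simp: X_def nbrs_def\<close>)
        then show "w' \<in> nbrs S w R" using w' by (auto simp: X_def nbrs_def)
      qed
      then have "card (X x - {w}) \<le> card (nbrs S w R)" using finR by (intro card_mono) auto
      then show ?thesis using w finX by simp
    qed
    then show "card (X x) * (card (X x) - 1) \<le> (\<Sum>w\<in>X x. card (nbrs S w R))"
      using sum_bounded_below[of "X x" "card (X x) - 1" "\<lambda>w. card (nbrs S w R)"] by simp
  qed
  also have "\<dots> = (\<Sum>w\<in>(\<Union>x\<in>J. X x). card (nbrs S w R))"
    using finX finJ(1) disj by (intro sum.UNION_disjoint[symmetric]) auto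
  also have "\<dots> \<le> pairs S R R"
    unfolding pairs_def using finR by (intro sum_mono2) (auto simp: X_def)
  finally have "real (\<Sum>x\<in>J. card (X x) * (card (X x) - 1)) \<le> real (pairs S R R)"
    by (simp only: of_nat_le_iff)
  moreover have "real (card (X x) * (card (X x) - 1)) = (real (card (X x)))\<^sup>2 - real (card (X x))" for x
    by (cases "card (X x)") (simp_all add: power2_eq_square algebra_simps)
  ultimately have sq: "(\<Sum>x\<in>J. (real (card (X x)))\<^sup>2) - real r \<le> real (pairs S R R)"
    by (simp add: r_def sum_subtractf)
  \<comment> \<open>Convexity through the tangent at the mean \<open>m\<close>: \<open>y\<^sup>2 \<ge> 2 m y - m\<^sup>2\<close>.\<close>
  define m where "m = real r / (real p - 1)"
  have "(\<Sum>x\<in>J. 2 * m * real (card (X x)) - m\<^sup>2) \<le> (\<Sum>x\<in>J. (real (card (X x)))\<^sup>2)"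
  proof (rule sum_mono)
    fix x
    have "0 \<le> (real (card (X x)) - m)\<^sup>2" by simp
    then show "2 * m * real (card (X x)) - m\<^sup>2 \<le> (real (card (X x)))\<^sup>2"
      by (simp add: power2_eq_square algebra_simps)
  qed
  moreover have "(\<Sum>x\<in>J. 2 * m * real (card (X x)) - m\<^sup>2) = 2 * m * real r - (real p - 1) * m\<^sup>2"
    using finJ p2 by (simp add: sum_subtractf r_def of_nat_diff flip: sum_distrib_left)
  moreover have "2 * m * real r - (real p - 1) * m\<^sup>2 = (real r)\<^sup>2 / (real p - 1)"
  proof -
    have "(real p - 1) * m = real r" using p2 by (simp add: m_def)
    then have "2 * m * real r - (real p - 1) * m\<^sup>2 = m * real r"
      by (simp add: power2_eq_square flip: mult.assoc)
    then show ?thesis by (simp add: m_def power2_eq_square)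
  qed
  ultimately have "(real r)\<^sup>2 / (real p - 1) - real r \<le> real (pairs S R R)" using sq by linarith
  then show thesis using that[of "real r"] r_le deg by simp
qed

end

section \<open>The lower bound\<close>

text \<open>Here \<open>k\<close> is the size of the packing. The first summand counts saturating edges meeting the packing, the second those
in the remainder. Their sum equals \<open>c/2 (n - k/2)\<^sup>2 + k\<^sup>2/2\<close> with \<open>c = (q - 1)\<^sup>2 / q\<^sup>3\<close>, and the
Cauchy-Schwarz inequality for \<open>n = (n - k/2) + k/2\<close> bounds it below by \<open>2 c / (4 + c) n\<^sup>2\<close>.\<close>

lemma density_tradeoff_square:
  fixes q n k :: real
  assumes "q \<ge> 2"
  shows "sat_density q * n\<^sup>2 \<le> (q - 1) / q * k * (n - (q + 1) * k / 2)
    + ((q - 1) / q * n - k * (q + 1) * (2 * q - 1) / (2 * q))\<^sup>2 / (2 * q)"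
proof -
  define c where "c = (q - 1)\<^sup>2 / q ^ 3"
  have c0: "c \<ge> 0" using assms by (simp add: c_def)
  have "(q - 1) / q * k * (n - (q + 1) * k / 2)
    + ((q - 1) / q * n - k * (q + 1) * (2 * q - 1) / (2 * q))\<^sup>2 / (2 * q)
    = c / 2 * (n - k / 2)\<^sup>2 + k\<^sup>2 / 2"
    using assms unfolding c_def by (simp add: field_simps power2_eq_square power3_eq_cube)
  moreover have "sat_density q = 2 * c / (4 + c)"
  proof -
    have "4 + c = (4 * q ^ 3 + (q - 1)\<^sup>2) / q ^ 3" using assms by (simp add: c_def field_simps)
    then show ?thesis using assms by (simp add: sat_density_def c_def)
  qed
  moreover have "2 * c * n\<^sup>2 \<le> (4 + c) * (c / 2 * (n - k / 2)\<^sup>2 + k\<^sup>2 / 2)"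
  proof -
    have "(4 + c) * (c / 2 * (n - k / 2)\<^sup>2 + k\<^sup>2 / 2) - 2 * c * n\<^sup>2
      = (c * (n - k / 2) - 2 * k)\<^sup>2 / 2"
      by (simp add: field_simps power2_eq_square)
    also have "\<dots> \<ge> 0" by simp
    finally show ?thesis by simp
  qed
  ultimately show ?thesis using c0 by (simp add: pos_divide_le_eq mult.commute)
qed

text \<open>For large \<open>k\<close> the guaranteed number \<open>M\<close> of sorted vertices is negative and its square no longer counts anything. The first
summand increases with \<open>k\<close> in the admissible range, so it may be compared with its value at the zero \<open>k'\<close> of \<open>M\<close>.\<close>

lemma density_tradeoff:
  fixes q n k :: real
  assumes q: "q \<ge> 2" and "0 \<le> k" and "(q + 1) * k \<le> n"
  defines "M \<equiv> (q - 1) / q * n - k * (q + 1) * (2 * q - 1) / (2 * q)"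
  shows "sat_density q * n\<^sup>2 \<le> (q - 1) / q * k * (n - (q + 1) * k / 2) + (max 0 M)\<^sup>2 / (2 * q)"
proof (cases "M \<ge> 0")
  case True
  then show ?thesis using density_tradeoff_square[OF q, of n k] by (simp add: M_def max_def)
next
  case False
  have n0: "n \<ge> 0" using assms by (meson add_nonneg_nonneg mult_nonneg_nonneg order_trans zero_le_numeral zero_le_one)
  define d where "d = (q + 1) * (2 * q - 1)"
  have den: "d > 0" using q by (simp add: d_def)
  define k' where "k' = 2 * (q - 1) * n / d"
  have k'd: "k' * d = 2 * (q - 1) * n" using den by (simp add: k'_def)
  have "k' * (q + 1) * (2 * q - 1) = 2 * (q - 1) * n" unfolding k'd[symmetric] by (simp add: d_def mult.assoc)
  then have "(q - 1) / q * n = k' * (q + 1) * (2 * q - 1) / (2 * q)"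
    using q by (simp only:) (simp add: field_simps)
  then have "sat_density q * n\<^sup>2 \<le> (q - 1) / q * (k' * (n - (q + 1) * k' / 2))"
    using density_tradeoff_square[OF q, of n k'] by (simp add: mult.assoc)
  also have "\<dots> \<le> (q - 1) / q * (k * (n - (q + 1) * k / 2))"
  proof (intro mult_left_mono)
    have "(q - 1) / q * n < k * d / (2 * q)"
      using False by (simp add: M_def d_def mult.assoc)
    then have "(q - 1) / q * n * (2 * q) < k * d" using q by (simp add: pos_less_divide_eq)
    moreover have "(q - 1) / q * n * (2 * q) = 2 * (q - 1) * n" using q by simp
    ultimately have "k' * d < k * d" using k'd by linarith
    then have k': "k' \<le> k" using den by simp
    have "(q + 1) * k' \<le> (q + 1) * k" using k' q by (intro mult_left_mono) auto
    then have "0 \<le> (k - k') * (n - (q + 1) * (k + k') / 2)"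
      using k' assms(3) by (intro mult_nonneg_nonneg) (auto simp: algebra_simps)
    then show "k' * (n - (q + 1) * k' / 2) \<le> k * (n - (q + 1) * k / 2)"
      by (simp add: field_simps)
  qed (use q in auto)
  finally show ?thesis using False by (simp add: max_def mult.assoc)
qed

text \<open>The arithmetic of the lower bound, for a packing of \<open>k\<close> cliques with remainder of size \<open>r\<close>. The quantities stand
for ordered pairs: \<open>eR\<close>, \<open>E\<close>, \<open>eW\<close> for edges inside the remainder, between remainder and packing, and inside
the packing; \<open>sR\<close>, \<open>sRW\<close>, \<open>sW\<close> for saturating edges at the same places; \<open>eT\<close> and \<open>eK\<close> for edges from the remainder
to a packed clique of at least average degree and to the clique exchanged for it.

Every edge to the packing beyond \<open>p - 2\<close> per clique yields a saturating edge, and the Turan bound for the remainder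
forces a large excess. Write \<open>k M\<close> for the excess
of edges between remainder and packing over \<open>p - 2\<close> per vertex and clique, and \<open>Q\<close> for the same excess inside the packing.
Counting all edges bounds \<open>2 k M + Q\<close> from below; as \<open>Q \<le> p k\<^sup>2\<close>, the average \<open>M\<close> is large, which feeds into \<open>\<rho>\<close>.
The hypothesis \<open>k \<ge> 1\<close> keeps the error in \<open>M\<close> bounded after dividing by \<open>k\<close>.\<close>

lemma saturating_count_bound:
  fixes p k n r E eR eW eT eK \<rho> sR sRW sW f :: real
  assumes p: "p \<ge> 3" and k: "k \<ge> 1" "p * k \<le> n" and r: "r = n - p * k"
    and edges: "(p - 2) / (p - 1) * n\<^sup>2 - (p - 1) \<le> eR + 2 * E + eW"
    and eR: "eR \<le> (p - 2) / (p - 1) * r\<^sup>2"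
    and eW: "eW \<le> (p - 1) * k * (p * k)"
    and sRW: "E \<le> (p - 2) * k * r + sRW"
    and sW: "eW \<le> (p - 2) * k * (p * k) + sW + p * k"
    and eT: "E / k \<le> eT" and eK: "eT \<le> eK + 2 * p\<^sup>2"
    and \<rho>: "0 \<le> \<rho>" "\<rho> \<le> r" "eK \<le> (p - 2) * r + \<rho>"
    and sR: "\<rho>\<^sup>2 / (p - 1) - \<rho> \<le> sR"
    and f: "2 * f = sR + 2 * sRW + sW"
  shows "sat_density (p - 1) * n\<^sup>2 - (3 * p\<^sup>2 + 2) * n \<le> f"
proof -
  define a where "a = (p - 2) / (p - 1)"
  define Q where "Q = eW - (p - 2) * k * (p * k)"
  define M where "M = E / k - (p - 2) * r"
  define M0 where "M0 = a * n - k * p * (2 * p - 3) / (2 * (p - 1))"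
  define m where "m = max 0 M0"
  have a: "0 \<le> a" "a \<le> 1" "(p - 1) * a = p - 2" using p by (simp_all add: a_def)
  have kM: "k * M = E - (p - 2) * k * r" using k by (simp add: M_def field_simps)
  have "p * k \<ge> p" using p k by simp
  then have n: "n \<ge> 0" "p \<le> n" using p k by linarith+
  have Q: "Q \<le> p * k\<^sup>2" using eW by (simp add: Q_def algebra_simps power2_eq_square)
  have "a * n\<^sup>2 - (p - 1) - a * r\<^sup>2 - 2 * ((p - 2) * k * r) - (p - 2) * k * (p * k) \<le> 2 * (k * M) + Q"
  proof -
    define X where "X = (p - 2) * k * r"
    define Y where "Y = (p - 2) * k * (p * k)"
    have "a * n\<^sup>2 - (p - 1) - a * r\<^sup>2 \<le> 2 * E + eW"
      using edges eR unfolding a_def[symmetric] by linarith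
    moreover have "k * M = E - X" "Q = eW - Y" by (simp_all add: kM Q_def X_def Y_def)
    ultimately show ?thesis unfolding X_def[symmetric] Y_def[symmetric] by linarith
  qed
  also have "a * n\<^sup>2 - (p - 1) - a * r\<^sup>2 - 2 * ((p - 2) * k * r) - (p - 2) * k * (p * k)
      = 2 * (a * k * (n - p * k / 2)) - (p - 1)"
    unfolding r a(3)[symmetric] by (simp add: field_simps power2_eq_square)
  finally have main: "2 * (a * k * (n - p * k / 2)) - (p - 1) \<le> 2 * (k * M) + Q" .
  have "k * (a * (n - p * k / 2) - p * k / 2 - (p - 1)) \<le> k * M"
  proof -
    have "(p - 1) * 1 \<le> (p - 1) * k" using p k by (intro mult_left_mono) auto
    then have "(p - 1) \<le> 2 * (k * (p - 1))" using p k by (simp add: mult.commute)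
    then have "2 * (k * (a * (n - p * k / 2) - p * k / 2 - (p - 1)))
      \<le> 2 * (a * k * (n - p * k / 2)) - (p - 1) - p * k\<^sup>2"
      by (simp add: algebra_simps power2_eq_square)
    then show ?thesis using main Q by linarith
  qed
  then have "a * (n - p * k / 2) - p * k / 2 - (p - 1) \<le> M" using k by simp
  moreover have "a * (n - p * k / 2) - p * k / 2 = M0"
  proof -
    have "(2 * p - 3) / (p - 1) = a + 1" using p by (simp add: a_def field_simps)
    then have eq: "k * p * (2 * p - 3) / (2 * (p - 1)) = k * p * (a + 1) / 2"
      by (metis (no_types, opaque_lifting) divide_divide_eq_left mult.commute times_divide_eq_right)
    show ?thesis unfolding M0_def eq by (simp add: algebra_simps)
  qed
  ultimately have "M0 - (p - 1) \<le> M" by simp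
  moreover have "p \<le> p\<^sup>2" using p by (simp add: power2_eq_square)
  ultimately have \<rho>M: "M0 - 3 * p\<^sup>2 \<le> \<rho>" using eT eK \<rho>(3) unfolding M_def by linarith
  have "0 \<le> k * p * (2 * p - 3) / (2 * (p - 1))" using p k by simp
  moreover have "a * n \<le> n" using a n by (simp add: mult_left_le_one_le)
  ultimately have m: "0 \<le> m" "m \<le> n" using n by (simp_all add: m_def M0_def)
  \<comment> \<open>The constant \<open>3 p\<^sup>2\<close> lost in \<open>\<rho>\<close> costs only a linear term after squaring, since \<open>m \<le> n\<close>.\<close>
  have sq: "m\<^sup>2 - 6 * p\<^sup>2 * n \<le> \<rho>\<^sup>2"
  proof (cases "m \<le> 3 * p\<^sup>2")
    case True
    then have "m * m \<le> 3 * p\<^sup>2 * n" using m by (intro mult_mono) auto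
    moreover have "0 \<le> p\<^sup>2 * n" using n by simp
    ultimately have "m\<^sup>2 - 6 * p\<^sup>2 * n \<le> 0" unfolding power2_eq_square[of m] by linarith
    then show ?thesis by (meson order_trans zero_le_power2)
  next
    case False
    then have "m = M0" using m by (auto simp: m_def max_def split: if_splits)
    then have "(m - 3 * p\<^sup>2)\<^sup>2 \<le> \<rho>\<^sup>2" using False \<rho>M by (intro power_mono) auto
    moreover have "(m - 3 * p\<^sup>2)\<^sup>2 = m\<^sup>2 - 6 * p\<^sup>2 * m + (3 * p\<^sup>2)\<^sup>2"
      by (simp add: power2_diff)
    moreover have "6 * p\<^sup>2 * m \<le> 6 * p\<^sup>2 * n" using m by (intro mult_left_mono) auto
    ultimately show ?thesis using zero_le_power2[of "3 * p\<^sup>2"] by linarith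
  qed
  have "(m\<^sup>2 - 6 * p\<^sup>2 * n) / (p - 1) \<le> \<rho>\<^sup>2 / (p - 1)" using sq p by (intro divide_right_mono) auto
  moreover have "6 * p\<^sup>2 * n / (p - 1) \<le> 6 * p\<^sup>2 * n / 1" using p n by (intro divide_left_mono) auto
  ultimately have inside: "m\<^sup>2 / (p - 1) - 6 * p\<^sup>2 * n \<le> \<rho>\<^sup>2 / (p - 1)"
    by (simp add: diff_divide_distrib)
  have "sat_density (p - 1) * n\<^sup>2 \<le> (p - 1 - 1) / (p - 1) * k * (n - (p - 1 + 1) * k / 2)
      + (max 0 ((p - 1 - 1) / (p - 1) * n - k * (p - 1 + 1) * (2 * (p - 1) - 1) / (2 * (p - 1))))\<^sup>2
        / (2 * (p - 1))"
    by (rule density_tradeoff) (use p k in auto)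
  then have "sat_density (p - 1) * n\<^sup>2 \<le> a * k * (n - p * k / 2) + m\<^sup>2 / (2 * (p - 1))"
    by (simp add: a_def m_def M0_def)
  moreover have "m\<^sup>2 / (2 * (p - 1)) = m\<^sup>2 / (p - 1) / 2" by simp
  ultimately have "sat_density (p - 1) * n\<^sup>2 \<le> a * k * (n - p * k / 2) + m\<^sup>2 / (p - 1) / 2" by (simp only:)
  moreover have "k * M \<le> sRW" using sRW kM by linarith
  moreover have "Q \<le> sW + p * k" using sW by (simp add: Q_def)
  moreover have "\<rho> \<le> n" using \<rho>(2) \<open>p * k \<ge> p\<close> p r by linarith
  \<comment> \<open>The nonlinear terms are abstracted so that linear arithmetic can combine the estimates.\<close>
  moreover define Z where "Z = a * k * (n - p * k / 2)"
  moreover define B where "B = p\<^sup>2 * n"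
  ultimately have "sat_density (p - 1) * n\<^sup>2 \<le> Z + m\<^sup>2 / (p - 1) / 2" "k * M \<le> sRW"
    "Q \<le> sW + p * k" "\<rho> \<le> n" "m\<^sup>2 / (p - 1) - 6 * B \<le> \<rho>\<^sup>2 / (p - 1)" "2 * Z - (p - 1) \<le> 2 * (k * M) + Q"
    using inside main by (simp_all add: mult.assoc)
  moreover define Y where "Y = m\<^sup>2 / (p - 1)"
  moreover define Y' where "Y' = \<rho>\<^sup>2 / (p - 1)"
  moreover define L where "L = sat_density (p - 1) * n\<^sup>2"
  moreover define G where "G = k * M"
  ultimately have "L \<le> Z + Y / 2" "G \<le> sRW" "Q \<le> sW + p * k" "\<rho> \<le> n"
    "Y - 6 * B \<le> Y'" "2 * Z - (p - 1) \<le> 2 * G + Q" "Y' - \<rho> \<le> sR"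
    using sR by (simp_all only:)
  then have "2 * L - 6 * B - 3 * n \<le> 2 * f"
    using f k(2) n(2) by linarith
  then show ?thesis using n by (simp add: B_def L_def algebra_simps)
qed

text \<open>A graph with more than \<open>ex_K n p\<close> edges contains a \<open>p\<close>-clique, so an optimal packing is nonempty. A packed clique with
at least average degree into the remainder supplies, after the exchange, the saturating edges inside the
remainder.\<close>

lemma min_saturating_lower:
  fixes p n :: nat
  assumes p: "p \<ge> 3" and n: "n \<ge> p"
  shows "sat_density (real p - 1) * (real n)\<^sup>2 - (3 * (real p)\<^sup>2 + 2) * real n
    \<le> real (min_saturating (p + 1) n (ex_K n p + 1))"
proof -
  let ?A = "{num_saturating (p + 1) V E | V E.
     sgraph V E \<and> card V = n \<and> card E = ex_K n p + 1 \<and> \<not> contains_K (p + 1) V E}"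
  have "min_saturating (p + 1) n (ex_K n p + 1) \<in> ?A"
    unfolding min_saturating_def
    by (rule Min_in[OF finite_min_saturating_set min_saturating_set_nonempty]) (use p n in auto)
  then obtain V E where VE: "sgraph V E" "card V = n" "card E = ex_K n p + 1" "\<not> contains_K (p + 1) V E"
    and min: "min_saturating (p + 1) n (ex_K n p + 1) = num_saturating (p + 1) V E"
    by blast
  interpret clique_free_graph V E p
    by unfold_locales (use VE p in auto)
  obtain P where opt: "optimal_packing P" using optimal_packing_exists by blast
  then have P: "packing P" by (simp add: optimal_packing_def)
  note finP = packing_finite[OF P]
  define k where "k = card P"
  define W where "W = \<Union>P"
  define R where "R = V - W"
  have sub: "W \<subseteq> V" "R \<subseteq> V" using finP(4) by (auto simp: W_def R_def)
  then have fin: "finite W" "finite R" "R \<inter> W = {}" "V = R \<union> W"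
    using finite_V finite_subset by (auto simp: R_def)
  have cW: "card W = k * p" using card_packing[OF P] by (simp add: W_def k_def)
  have cR: "n = card R + k * p" using fin cW VE(2) by (simp add: card_Un_disjoint)
  have "contains_K p V E"
  proof (rule ccontr)
    assume "\<not> contains_K p V E"
    then have "card E \<le> ex_K n p"
      unfolding ex_K_def by (intro Max_ge[OF finite_ex_K_set]) (use VE in blast)
    then show False using VE(3) by simp
  qed
  then obtain K0 where "Kp K0" by (auto simp: contains_K_def Kp_def)
  then have "packing {K0}" by (simp add: packing_def)
  then have "card {K0} \<le> card P" using opt unfolding optimal_packing_def by blast
  then have k1: "k \<ge> 1" by (simp add: k_def)
  define eRW where "eRW = pairs E R W"
  obtain T where T: "T \<in> P" "real eRW \<le> real k * real (pairs E R T)"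
  proof -
    have "\<exists>T\<in>P. eRW \<le> k * pairs E R T"
    proof (rule ccontr)
      assume "\<not> ?thesis"
      then have less: "\<And>T. T \<in> P \<Longrightarrow> k * pairs E R T < eRW" by force
      have "eRW = (\<Sum>T\<in>P. pairs E R T)" unfolding eRW_def W_def using pairs_Union finP by blast
      then have "k * eRW = (\<Sum>T\<in>P. k * pairs E R T)" by (simp add: sum_distrib_left)
      also have "\<dots> < (\<Sum>T\<in>P. eRW)"
        using less finP(1) k1 by (intro sum_strict_mono) (auto simp: k_def)
      finally show False by (simp add: k_def)
    qed
    then show thesis using that by (metis of_nat_le_iff of_nat_mult)
  qed
  obtain K t where K: "Kp K" "t \<in> K" "\<And>w. w \<in> R \<Longrightarrow> \<exists>x\<in>K - {t}. {w, x} \<notin> E"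
    "pairs E R T \<le> pairs E R K + 2 * p\<^sup>2"
    using exchange_clique[OF opt T(1)] unfolding R_def W_def by blast
  obtain \<rho> :: real where \<rho>: "0 \<le> \<rho>" "\<rho> \<le> real (card R)"
    "real (pairs E R K) \<le> (real p - 2) * real (card R) + \<rho>"
    "\<rho>\<^sup>2 / (real p - 1) - \<rho> \<le> real (pairs S R R)"
    using saturating_pairs_inside[OF K(1) sub(2) K(2,3)] by blast
  have S2: "S \<subseteq> [V]\<^bsup>2\<^esup>" by (auto simp: S_def saturating_edges_def)
  have E2: "E \<subseteq> [V]\<^bsup>2\<^esup>" using VE(1) by (simp add: sgraph_def)
  have split: "pairs F V V = pairs F R R + 2 * pairs F R W + pairs F W W" for F
    by (subst (1 2) fin(4)) (rule pairs_square_Un[OF fin(2,1,3)])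
  have real2: "real (p - 2) = real p - 2" "real (p - 1) = real p - 1" using p by auto
  have rr: "real (card R) = real n - real p * real k" using cR by simp
  have pk: "real p * real k \<le> real n" using rr of_nat_0_le_iff[of "card R"] by linarith
  show ?thesis
    unfolding min
  proof (rule saturating_count_bound)
    show "3 \<le> real p" using p by simp
    show "1 \<le> real k" using k1 by simp
    show "real p * real k \<le> real n" by (rule pk)
    show "real (card R) = real n - real p * real k" by (rule rr)
    show "(real p - 2) / (real p - 1) * (real n)\<^sup>2 - (real p - 1)
        \<le> real (pairs E R R) + 2 * real eRW + real (pairs E W W)"
    proof -
      have "(real (p - 1) - 1) / real (p - 1) * (real n)\<^sup>2 - real (p - 1) \<le> 2 * real (ex_K n (p - 1 + 1))"
        by (rule ex_K_ge) (use p in simp)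
      moreover have "2 * card E = pairs E R R + 2 * eRW + pairs E W W"
        using pairs_eq_twice_card[OF finite_V E2] split[of E] by (simp add: eRW_def)
      then have "real (2 * card E) = real (pairs E R R + 2 * eRW + pairs E W W)"
        by (simp only:)
      ultimately show ?thesis using VE(3) p by (simp add: real2)
    qed
    show "real (pairs E R R) \<le> (real p - 2) / (real p - 1) * (real (card R))\<^sup>2"
      using turan_bound[OF fin(2) no_loop, of "p - 1"] remainder_Kp_free[OF opt] p
      by (simp add: real2 R_def W_def)
    show "real (pairs E W W) \<le> (real p - 1) * real k * (real p * real k)"
    proof -
      have "real (pairs E W W) \<le> real (k * ((p - 1) * card W))"
        using pairs_packing_le_trivial[OF P sub(1)] by (simp only: W_def k_def of_nat_le_iff)
      then show ?thesis by (simp only: cW of_nat_mult of_nat_add real2 Int_absorb mult_ac)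
    qed
    show "real eRW \<le> (real p - 2) * real k * real (card R) + real (pairs S R W)"
    proof -
      have "real eRW \<le> real (k * ((p - 2) * card R) + pairs S R W + card (R \<inter> W))"
        using pairs_packing_le[OF P sub(2)] by (simp only: W_def k_def of_nat_le_iff eRW_def)
      then show ?thesis by (simp only: fin(3) card.empty add_0_right of_nat_mult of_nat_add real2 mult_ac)
    qed
    show "real (pairs E W W) \<le> (real p - 2) * real k * (real p * real k) + real (pairs S W W) + real p * real k"
    proof -
      have "real (pairs E W W) \<le> real (k * ((p - 2) * card W) + pairs S W W + card (W \<inter> W))"
        using pairs_packing_le[OF P sub(1)] by (simp only: W_def k_def of_nat_le_iff)
      then show ?thesis by (simp only: cW of_nat_mult of_nat_add real2 Int_absorb mult_ac)
    qed
    show "real eRW / real k \<le> real (pairs E R T)"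
      using T(2) k1 by (simp add: divide_le_eq mult.commute)
    show "real (pairs E R T) \<le> real (pairs E R K) + 2 * (real p)\<^sup>2"
    proof -
      have "real (pairs E R T) \<le> real (pairs E R K + 2 * p\<^sup>2)" using K(4) by (simp only: of_nat_le_iff)
      then show ?thesis by simp
    qed
    show "2 * real (num_saturating (p + 1) V E)
        = real (pairs S R R) + 2 * real (pairs S R W) + real (pairs S W W)"
    proof -
      have "2 * num_saturating (p + 1) V E = pairs S R R + 2 * pairs S R W + pairs S W W"
        using pairs_eq_twice_card[OF finite_V S2] split[of S] by (simp add: num_saturating_def S_def)
      then have "real (2 * num_saturating (p + 1) V E) = real (pairs S R R + 2 * pairs S R W + pairs S W W)"
        by (simp only:)
      then show ?thesis by simp
    qed
  qed (use \<rho> in auto)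
qed

section \<open>The asymptotic formula\<close>

theorem theorem1p2:
  fixes p :: nat
  assumes "p \<ge> 3"
  shows "\<exists>\<epsilon> :: nat \<Rightarrow> real. \<epsilon> \<longlonglongrightarrow> 0 \<and>
    (\<forall>n\<ge>p. real (min_saturating (p + 1) n (ex_K n p + 1)) =
       (2 * (real p - 2)^2 / (real p * (4 * (real p)^2 - 11 * real p + 8)) + \<epsilon> n) * (real n)^2)"
proof -
  define F where "F n = real (min_saturating (p + 1) n (ex_K n p + 1))" for n
  define D where "D = sat_density (real p - 1)"
  define C where "C = 3 * (real p)\<^sup>2 + 5 * real p + 2"
  define q where "q = p - 1"
  have q: "p = q + 1" "q \<ge> 2" "real q = real p - 1" using assms by (auto simp: q_def)
  have D: "D = 2 * (real p - 2)^2 / (real p * (4 * (real p)^2 - 11 * real p + 8))"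
  proof -
    have "4 * (real p - 1) ^ 3 + (real p - 1 - 1)\<^sup>2 = real p * (4 * (real p)\<^sup>2 - 11 * real p + 8)"
      by (simp add: power2_eq_square power3_eq_cube algebra_simps)
    then show ?thesis by (simp add: D_def sat_density_def)
  qed
  have bound: "\<bar>F n / (real n)\<^sup>2 - D\<bar> \<le> C / real n" if n: "n \<ge> 2 * q * (3 * q + 1)" for n
  proof -
    have "q + 1 \<le> 2 * q * (3 * q + 1)" using q(2) by (simp add: algebra_simps)
    then have np: "n \<ge> p" "real n > 0" using n q by auto
    have "D * (real n)\<^sup>2 - (3 * (real p)\<^sup>2 + 2) * real n \<le> F n"
      using min_saturating_lower[OF assms np(1)] by (simp add: F_def D_def)
    moreover have "F n \<le> D * (real n)\<^sup>2 + (5 * real q + 5) * real n"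
      using min_saturating_upper[OF q(2) n] by (simp add: F_def D_def q(1))
    moreover have "(3 * (real p)\<^sup>2 + 2) * real n \<le> C * real n" "(5 * real q + 5) * real n \<le> C * real n"
      using np(2) by (auto simp: C_def q(3) intro!: mult_right_mono)
    ultimately have "\<bar>F n - D * (real n)\<^sup>2\<bar> \<le> C * real n" by linarith
    then have "\<bar>F n - D * (real n)\<^sup>2\<bar> / (real n)\<^sup>2 \<le> C * real n / (real n)\<^sup>2"
      by (intro divide_right_mono) auto
    moreover have "F n / (real n)\<^sup>2 - D = (F n - D * (real n)\<^sup>2) / (real n)\<^sup>2"
      using np(2) by (simp add: diff_divide_distrib)
    then have "\<bar>F n / (real n)\<^sup>2 - D\<bar> = \<bar>F n - D * (real n)\<^sup>2\<bar> / (real n)\<^sup>2"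
      by (simp only: abs_divide abs_power2)
    ultimately show ?thesis using np(2) by (simp add: power2_eq_square)
  qed
  have "(\<lambda>n. F n / (real n)\<^sup>2 - D) \<longlonglongrightarrow> 0"
  proof (rule tendsto_0_le[where K = 1])
    show "(\<lambda>n. C / real n) \<longlonglongrightarrow> 0" by (rule lim_const_over_n)
    show "\<forall>\<^sub>F n in sequentially. norm (F n / (real n)\<^sup>2 - D) \<le> norm (C / real n) * 1"
    proof (rule eventually_sequentiallyI)
      fix n assume "2 * q * (3 * q + 1) \<le> n"
      then show "norm (F n / (real n)\<^sup>2 - D) \<le> norm (C / real n) * 1"
        using order_trans[OF bound abs_ge_self] by (simp only: real_norm_def mult_1_right)
    qed
  qed
  moreover have "F n = (D + (F n / (real n)\<^sup>2 - D)) * (real n)\<^sup>2" if "n \<ge> p" for n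
    using that assms by simp
  ultimately show ?thesis
    unfolding D[symmetric] F_def[symmetric]
    by (intro exI[of _ "\<lambda>n. F n / (real n)\<^sup>2 - D"]) blast
qed

end
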